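(* Let $(\underline{Y}_t)_{t\in\mathbb{Z}}$ be the stationary solution of the model $$\underline{Y}_t=A(\underline{\eta}_t)\underline{Y}_{t-1}+\underline{B}(\underline{\eta}_t).$$ Let $r>2$ be an integer and assume that $\kappa_{2(r-1)}<+\infty$, where $\kappa_k:=E\{\varepsilon_t^{2k}\}$. 1. If $\rho\left(\prod_{v=0}^{s-1}E\left\{\phi_{s-v}^{\otimes r}(\underline{\eta}_t)\right\}\right)<1$, then $\underline{Y}_t\in\mathbb{L}^r$. 2. Conversely, if $\rho\left(\prod_{v=0}^{s-1}E\left\{\phi_{s-v}^{\otimes r}(\underline{\eta}_t)\right\}\right)\ge 1$, then there is no strictly stationary solution $(\underline{Y}_t)_{t\in\mathbb{Z}}$ of the model such that $E\{\underline{Y}_t^{\otimes r}\}<+\infty$.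
   Context: Model. Fix integers $s,p,q\ge 1$ and put $d=p+q$. The periodic GARCH (PGARCH) process $(x_t)_{t\in\mathbb{Z}}$ of period $s$ satisfies, for $t\in\mathbb{Z}$ and $v=1,\dots,s$, $x_{st+v}=\varepsilon_{st+v}\sqrt{h_{st+v}}$ and $h_{st+v}=\alpha_0(v)+\sum_{i=1}^p\alpha_i(v)x_{st+v-i}^2+\sum_{j=1}^q\beta_j(v)h_{st+v-j}$, where $\alpha_0(v)>0$, $\alpha_i(v)\ge 0$, $\beta_j(v)\ge 0$ are constants. The $(\varepsilon_t)_{t\in\mathbb{Z}}$ are i.i.d. real random variables with $E\varepsilon_t=E\varepsilon_t^3=0$ and $E\varepsilon_t^2=1$; $\varepsilon_k$ is independent of $x_t$ for $k>t$. Vector form. Put $y_t=x_t^2$, $\eta_t=\varepsilon_t^2$, $\underline{\eta}_t=(\eta_{st+1},\dots,\eta_{st+s})'\in\mathbb{R}^s$ (an i.i.d. sequence), $\underline{y}_{st+v}=(y_{st+v},\dots,y_{st+v-p+1},h_{st+v},\dots,h_{st+v-q+1})'\in\mathbb{R}^d$ and $\underline{Y}_t=(\underline{y}_{st+1}',\dots,\underline{y}_{st+s}')'\in\mathbb{R}^{ds}$. Since $\underline{Y}_t$ is made of squares $x^2$ and volatilities $h$, solutions $(\underline{Y}_t)$ of the model are understood to have nonnegative components. For $v=1,\dots,s$, $\underline{B}_v(\underline{\eta}_t)\in\mathbb{R}^d$ has first coordinate $\alpha_0(v)\eta_{st+v}$, $(p+1)$-th coordinate $\alpha_0(v)$, and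 all other coordinates $0$; and $\phi_v(\underline{\eta}_t)$ is the $d\times d$ matrix $$\phi_v(\underline{\eta}_t)=\begin{pmatrix} A_v(\underline{\eta}_t) & B_v(\underline{\eta}_t) \\ A_v & B_v \end{pmatrix},$$ where: $A_v(\underline{\eta}_t)$ is the $p\times p$ matrix with first row $(\alpha_1(v)\eta_{st+v},\dots,\alpha_p(v)\eta_{st+v})$, ones on the first subdiagonal and zeros elsewhere; $B_v(\underline{\eta}_t)$ is the $p\times q$ matrix with first row $(\beta_1(v)\eta_{st+v},\dots,\beta_q(v)\eta_{st+v})$ and zeros elsewhere; $A_v$ is the $q\times p$ matrix with first row $(\alpha_1(v),\dots,\alpha_p(v))$ and zeros elsewhere; $B_v$ is the $q\times q$ matrix with first row $(\beta_1(v),\dots,\beta_q(v))$, ones on the first subdiagonal and zeros elsewhere. Products $\prod_{j=a}^{b}M_j$ of matrices are ordered $M_aM_{a+1}\cdots M_b$; empty products are identity matrices. $\rho(\cdot)$ is the spectral radius, and $M^{\otimes m}=M\otimes\cdots\otimes M$ ($m$ times, $m\ge1$ an integer) is the Kronecker power. $A(\underline{\eta}_t)$ is the $ds\times ds$ matrix, in $d\times d$ blocks, whose first $s-1$ block columns are zero and whose last block column has $v$-th block $\phi_v(\underline{\eta}_t)\cdots\phi_1(\underline{\eta}_t)$, $v=1,\dots,s$. $\underline{B}(\underline{\eta}_t)\in\mathbb{R}^{ds}$ has $v$-th block $\sum_{k=1}^{v}\{\prod_{i=0}^{v-k-1}\phi_{v-i}(\underline{\eta}_t)\}\underline{B}_k(\underline{\eta}_t)$,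 $v=1,\dots,s$. $\underline{Y}_t\in\mathbb{L}^r$ means $E\|\underline{Y}_t\|^r<\infty$; $E\{\underline{Y}_t^{\otimes r}\}<+\infty$ means all components are finite. *)

theory Defs
  imports "HOL-Probability.Probability" "Jordan_Normal_Form.Spectral_Radius"
begin

unbundle no vec_syntax
hide_const (open) Finite_Cartesian_Product.vec Finite_Cartesian_Product.mat
hide_type (open) Finite_Cartesian_Product.vec

section \<open>Matrix products, Kronecker powers, expectations\<close>

text \<open>The ordered product \<open>F 0 * F 1 * ... * F (k - 1)\<close> of \<open>n \<times> n\<close> matrices.\<close>

fun mat_prod :: "nat \<Rightarrow> (nat \<Rightarrow> 'a :: semiring_1 mat) \<Rightarrow> nat \<Rightarrow> 'a mat" where
  "mat_prod n F 0 = 1\<^sub>m n"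
| "mat_prod n F (Suc k) = mat_prod n F k * F k"

definition kron :: "'a :: times mat \<Rightarrow> 'a mat \<Rightarrow> 'a mat" where
  "kron A B = mat (dim_row A * dim_row B) (dim_col A * dim_col B)
     (\<lambda>(i, j). A $$ (i div dim_row B, j div dim_col B) * B $$ (i mod dim_row B, j mod dim_col B))"

fun kron_pow :: "'a :: semiring_1 mat \<Rightarrow> nat \<Rightarrow> 'a mat" where
  "kron_pow A 0 = 1\<^sub>m 1"
| "kron_pow A (Suc m) = kron A (kron_pow A m)"

definition col_mat :: "'a vec \<Rightarrow> 'a mat" where
  "col_mat x = mat_of_cols (dim_vec x) [x]"

definition eucl_norm :: "real vec \<Rightarrow> real" where
  "eucl_norm x = sqrt (\<Sum>i<dim_vec x. (x $ i)\<^sup>2)"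

definition expect_mat :: "'w measure \<Rightarrow> nat \<Rightarrow> nat \<Rightarrow> ('w \<Rightarrow> real mat) \<Rightarrow> real mat" where
  "expect_mat M nr nc X = mat nr nc (\<lambda>(i, j). \<integral>\<omega>. X \<omega> $$ (i, j) \<partial>M)"

definition expect_mat_finite :: "'w measure \<Rightarrow> nat \<Rightarrow> nat \<Rightarrow> ('w \<Rightarrow> real mat) \<Rightarrow> bool" where
  "expect_mat_finite M nr nc X \<longleftrightarrow> (\<forall>i<nr. \<forall>j<nc. integrable M (\<lambda>\<omega>. X \<omega> $$ (i, j)))"

definition in_L :: "'w measure \<Rightarrow> nat \<Rightarrow> ('w \<Rightarrow> real vec) \<Rightarrow> bool" where
  "in_L M r X \<longleftrightarrow> integrable M (\<lambda>\<omega>. eucl_norm (X \<omega>) ^ r)"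

definition real_spectral_radius :: "real mat \<Rightarrow> real" where
  "real_spectral_radius A = spectral_radius (map_mat complex_of_real A)"

section \<open>The periodic GARCH model\<close>

text \<open>
  Coefficients are \<open>\<alpha> i v = \<alpha>\<^sub>i(v)\<close> (with \<open>\<alpha> 0 v\<close> the intercept) and \<open>\<beta> j v = \<beta>\<^sub>j(v)\<close>,
  for seasons \<open>v = 1, ..., s\<close>. Coordinates of vectors are counted from \<open>0\<close>, so in an
  argument \<open>e\<close> standing for \<open>(\<eta>\<^bsub>st+1\<^esub>, ..., \<eta>\<^bsub>st+s\<^esub>)\<close> the entry \<open>\<eta>\<^bsub>st+v\<^esub>\<close> is \<open>e $ (v - 1)\<close>.
\<close>

definition pgarch_coeffs ::
    "nat \<Rightarrow> nat \<Rightarrow> nat \<Rightarrow> (nat \<Rightarrow> nat \<Rightarrow> real) \<Rightarrow> (nat \<Rightarrow> nat \<Rightarrow> real) \<Rightarrow> bool" where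
  "pgarch_coeffs s p q \<alpha> \<beta> \<longleftrightarrow>
     (\<forall>v\<in>{1..s}. \<alpha> 0 v > 0 \<and> (\<forall>i\<in>{1..p}. \<alpha> i v \<ge> 0) \<and> (\<forall>j\<in>{1..q}. \<beta> j v \<ge> 0))"

definition innovations :: "'w measure \<Rightarrow> (int \<Rightarrow> 'w \<Rightarrow> real) \<Rightarrow> bool" where
  "innovations M \<epsilon> \<longleftrightarrow>
     prob_space.indep_vars M (\<lambda>_. borel) \<epsilon> UNIV \<and>
     (\<forall>t. distr M borel (\<epsilon> t) = distr M borel (\<epsilon> 0)) \<and>
     (\<forall>t. has_bochner_integral M (\<epsilon> t) 0) \<and>
     (\<forall>t. has_bochner_integral M (\<lambda>\<omega>. \<epsilon> t \<omega> ^ 2) 1) \<and>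
     (\<forall>t. has_bochner_integral M (\<lambda>\<omega>. \<epsilon> t \<omega> ^ 3) 0)"

text \<open>Time \<open>0\<close> stands for an arbitrary time here, the \<open>\<epsilon> t\<close> being identically distributed.\<close>

definition kappa :: "'w measure \<Rightarrow> (int \<Rightarrow> 'w \<Rightarrow> real) \<Rightarrow> nat \<Rightarrow> ennreal" where
  "kappa M \<epsilon> k = (\<integral>\<^sup>+\<omega>. ennreal (\<epsilon> 0 \<omega> ^ (2 * k)) \<partial>M)"

definition eta_vec :: "nat \<Rightarrow> (int \<Rightarrow> 'w \<Rightarrow> real) \<Rightarrow> int \<Rightarrow> 'w \<Rightarrow> real vec" where
  "eta_vec s \<epsilon> t \<omega> = vec s (\<lambda>i. (\<epsilon> (int s * t + int (i + 1)) \<omega>)\<^sup>2)"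

definition phi ::
    "nat \<Rightarrow> nat \<Rightarrow> (nat \<Rightarrow> nat \<Rightarrow> real) \<Rightarrow> (nat \<Rightarrow> nat \<Rightarrow> real) \<Rightarrow> nat \<Rightarrow> real vec \<Rightarrow> real mat" where
  "phi p q \<alpha> \<beta> v e = four_block_mat
     (mat p p (\<lambda>(i, j). if i = 0 then \<alpha> (j + 1) v * e $ (v - 1) else if i = j + 1 then 1 else 0))
     (mat p q (\<lambda>(i, j). if i = 0 then \<beta> (j + 1) v * e $ (v - 1) else 0))
     (mat q p (\<lambda>(i, j). if i = 0 then \<alpha> (j + 1) v else 0))
     (mat q q (\<lambda>(i, j). if i = 0 then \<beta> (j + 1) v else if i = j + 1 then 1 else 0))"

definition B_season :: "nat \<Rightarrow> nat \<Rightarrow> (nat \<Rightarrow> nat \<Rightarrow> real) \<Rightarrow> nat \<Rightarrow> real vec \<Rightarrow> real vec" where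
  "B_season p q \<alpha> v e =
     vec (p + q) (\<lambda>i. if i = 0 then \<alpha> 0 v * e $ (v - 1) else if i = p then \<alpha> 0 v else 0)"

text \<open>Index \<open>i\<close> of a stacked vector belongs to the block of season \<open>i div (p + q) + 1\<close>.\<close>

definition A_mat ::
    "nat \<Rightarrow> nat \<Rightarrow> nat \<Rightarrow> (nat \<Rightarrow> nat \<Rightarrow> real) \<Rightarrow> (nat \<Rightarrow> nat \<Rightarrow> real) \<Rightarrow> real vec \<Rightarrow> real mat" where
  "A_mat s p q \<alpha> \<beta> e = (let d = p + q in
     mat (d * s) (d * s) (\<lambda>(i, j).
       if j < d * (s - 1) then 0
       else let v = i div d + 1
            in mat_prod d (\<lambda>k. phi p q \<alpha> \<beta> (v - k) e) v $$ (i mod d, j - d * (s - 1))))"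

definition B_vec ::
    "nat \<Rightarrow> nat \<Rightarrow> nat \<Rightarrow> (nat \<Rightarrow> nat \<Rightarrow> real) \<Rightarrow> (nat \<Rightarrow> nat \<Rightarrow> real) \<Rightarrow> real vec \<Rightarrow> real vec" where
  "B_vec s p q \<alpha> \<beta> e = (let d = p + q in
     vec (d * s) (\<lambda>i. let v = i div d + 1 in
       \<Sum>k = 1..v. (mat_prod d (\<lambda>l. phi p q \<alpha> \<beta> (v - l) e) (v - k) *\<^sub>v B_season p q \<alpha> k e) $ (i mod d)))"

text \<open>
  For \<open>t\<close> and \<open>v = 1, ..., s\<close>: the observation \<open>x\<^bsub>st+v\<^esub> = \<epsilon>\<^bsub>st+v\<^esub> \<surd>h\<^bsub>st+v\<^esub>\<close>; the volatility
  \<open>h\<^bsub>st+v\<^esub>\<close> is the coordinate following the first \<open>p\<close> ones in the \<open>v\<close>-th block of \<open>Y t\<close>.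
\<close>

definition x_obs ::
    "nat \<Rightarrow> nat \<Rightarrow> nat \<Rightarrow> (int \<Rightarrow> 'w \<Rightarrow> real) \<Rightarrow> (int \<Rightarrow> 'w \<Rightarrow> real vec) \<Rightarrow> int \<Rightarrow> nat \<Rightarrow> 'w \<Rightarrow> real" where
  "x_obs s p q \<epsilon> Y t v \<omega> =
     \<epsilon> (int s * t + int v) \<omega> * sqrt (Y t \<omega> $ ((p + q) * (v - 1) + p))"

definition pgarch_solution ::
    "'w measure \<Rightarrow> nat \<Rightarrow> nat \<Rightarrow> nat \<Rightarrow> (nat \<Rightarrow> nat \<Rightarrow> real) \<Rightarrow> (nat \<Rightarrow> nat \<Rightarrow> real) \<Rightarrow>
       (int \<Rightarrow> 'w \<Rightarrow> real) \<Rightarrow> (int \<Rightarrow> 'w \<Rightarrow> real vec) \<Rightarrow> bool" where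
  "pgarch_solution M s p q \<alpha> \<beta> \<epsilon> Y \<longleftrightarrow>
     (\<forall>t. \<forall>\<omega>\<in>space M. Y t \<omega> \<in> carrier_vec ((p + q) * s)) \<and>
     (\<forall>t. \<forall>i<(p + q) * s. (\<lambda>\<omega>. Y t \<omega> $ i) \<in> borel_measurable M) \<and>
     (\<forall>t. AE \<omega> in M. \<forall>i<(p + q) * s. Y t \<omega> $ i \<ge> 0) \<and>
     (\<forall>t. AE \<omega> in M. Y t \<omega> =
        A_mat s p q \<alpha> \<beta> (eta_vec s \<epsilon> t \<omega>) *\<^sub>v Y (t - 1) \<omega> + B_vec s p q \<alpha> \<beta> (eta_vec s \<epsilon> t \<omega>)) \<and>
     (\<forall>t. \<forall>v\<in>{1..s}. \<forall>k > int s * t + int v.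
        prob_space.indep_var M borel (\<epsilon> k) borel (x_obs s p q \<epsilon> Y t v))"

text \<open>Shift invariance of the finite-dimensional laws of an \<open>n\<close>-dimensional process.\<close>

definition strictly_stationary ::
    "'w measure \<Rightarrow> nat \<Rightarrow> (int \<Rightarrow> 'w \<Rightarrow> real vec) \<Rightarrow> bool" where
  "strictly_stationary M n Y \<longleftrightarrow>
     (\<forall>J h. finite J \<longrightarrow>
        distr M (Pi\<^sub>M (J \<times> {..<n}) (\<lambda>_. borel)) (\<lambda>\<omega>. \<lambda>(t, i)\<in>J \<times> {..<n}. Y (t + h) \<omega> $ i) =
        distr M (Pi\<^sub>M (J \<times> {..<n}) (\<lambda>_. borel)) (\<lambda>\<omega>. \<lambda>(t, i)\<in>J \<times> {..<n}. Y t \<omega> $ i))"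

text \<open>
  The matrix \<open>E \<phi>\<^sub>s\<^sup>\<otimes>\<^sup>r \<cdots> E \<phi>\<^sub>1\<^sup>\<otimes>\<^sup>r\<close>. It does not depend on the time at which the innovations are
  taken, here \<open>0\<close>, since these are identically distributed.
\<close>

definition moment_mat ::
    "'w measure \<Rightarrow> nat \<Rightarrow> nat \<Rightarrow> nat \<Rightarrow> (nat \<Rightarrow> nat \<Rightarrow> real) \<Rightarrow> (nat \<Rightarrow> nat \<Rightarrow> real) \<Rightarrow>
       (int \<Rightarrow> 'w \<Rightarrow> real) \<Rightarrow> nat \<Rightarrow> real mat" where
  "moment_mat M s p q \<alpha> \<beta> \<epsilon> r = (let D = (p + q) ^ r in
     mat_prod D
       (\<lambda>v. expect_mat M D D (\<lambda>\<omega>. kron_pow (phi p q \<alpha> \<beta> (s - v) (eta_vec s \<epsilon> 0 \<omega>)) r)) s)"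

end

theory Submission
  imports Defs
begin

text \<open>
  The stacked recursion is unstacked: the block \<open>u\<^sub>t\<close> of \<open>Y\<close> belonging to a single time \<open>t\<close> satisfies
  \<open>u\<^sub>t = G\<^sub>t u\<^sub>t\<^sub>-\<^sub>1 + B\<^sub>t\<close>, where \<open>G\<^sub>t\<close> is the matrix \<open>\<phi>\<close> of the season of \<open>t\<close>, and \<open>G\<^sub>t\<close>, \<open>B\<^sub>t\<close>
  depend on the single innovation \<open>\<epsilon>\<^sub>t\<close> and have nonnegative entries. Let
  \<open>P\<^sub>n = G\<^sub>t G\<^sub>t\<^sub>-\<^sub>1 \<cdots> G\<^sub>t\<^sub>-\<^sub>n\<^sub>+\<^sub>1\<close>, and measure nonnegative matrices and vectors by the sum of their
  entries. Kronecker powers are multiplicative and the sum of the entries of \<open>A\<^sup>\<otimes>\<^sup>r\<close> is the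
  \<open>r\<close>-th power of that of \<open>A\<close>. By independence of the innovations the \<open>r\<close>-th moment of the size of
  \<open>P\<^sub>n\<close> is therefore exactly the size of the product of the \<open>n\<close> matrices \<open>E G\<^sup>\<otimes>\<^sup>r\<close>
  (\<open>nn_integral_sum_P\<close>), which for whole periods from a time \<open>t\<close> of season \<open>s\<close> is a
  power of \<open>moment_mat\<close>.

  If the spectral radius is below one, these moments decay geometrically. Then the series of the
  terms \<open>P\<^sub>k B\<^sub>t\<^sub>-\<^sub>k\<close> is bounded in \<open>L\<^sup>r\<close>, and the remainder \<open>P\<^sub>n u\<^sub>t\<^sub>-\<^sub>n\<close> tends to zero in
  probability along whole periods, because \<open>u\<close> is stationary along them
  (\<open>nn_integral_power_finite\<close>).

  Conversely, within \<open>p + q\<close> steps the positive intercepts reach every coordinate of the state, so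
  that \<open>u\<^sub>t \<ge> P\<^sub>N u\<^sub>t\<^sub>-\<^sub>N + a \<xi>\<^sub>t (1, \<dots>, 1)\<close> for a multiple \<open>N\<close> of the period, a constant
  \<open>a > 0\<close>, and a nonnegative function \<open>\<xi>\<^sub>t\<close> of finitely many innovations that is not almost surely
  zero (\<open>floor_noise\<close>, \<open>state_lower_bound\<close>). Iterating this and using superadditivity of the \<open>r\<close>-th power, a
  finite \<open>r\<close>-th moment of \<open>u\<^sub>t\<close> bounds the sum over \<open>j\<close> of the \<open>r\<close>-th moments of the sizes of
  \<open>P\<^sub>j\<^sub>N\<close>. So the corresponding powers of \<open>moment_mat\<close> tend to zero, which forces the spectral
  radius below one (\<open>spectral_radius_less_1_if_moment_finite\<close>).
\<close>

section \<open>Ordered products\<close>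

lemma mat_prod_carrier [simp, intro]:
  assumes "\<And>k. k < n \<Longrightarrow> F k \<in> carrier_mat d d"
  shows "mat_prod d F n \<in> carrier_mat d d"
  using assms by (induction n) auto

lemma mat_prod_cong:
  assumes "\<And>k. k < n \<Longrightarrow> F k = G k"
  shows "mat_prod d F n = mat_prod d G n"
  using assms by (induction n) auto

lemma mat_prod_add:
  assumes "\<And>k. k < m + n \<Longrightarrow> F k \<in> carrier_mat d d"
  shows "mat_prod d F (m + n) = mat_prod d F m * mat_prod d (\<lambda>k. F (m + k)) n"
  using assms
proof (induction n)
  case 0
  then have "mat_prod d F m \<in> carrier_mat d d" by (intro mat_prod_carrier) auto
  then show ?case by simp
next
  case (Suc n)
  have "mat_prod d F m \<in> carrier_mat d d" "mat_prod d (\<lambda>k. F (m + k)) n \<in> carrier_mat d d"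
    "F (m + n) \<in> carrier_mat d d"
    using Suc.prems by (auto intro!: mat_prod_carrier)
  then show ?case using Suc by (simp add: assoc_mult_mat[of _ d d _ d _ d])
qed

lemma mat_prod_Suc_left:
  assumes "\<And>k. k < Suc n \<Longrightarrow> F k \<in> carrier_mat d d"
  shows "mat_prod d F (Suc n) = F 0 * mat_prod d (\<lambda>k. F (Suc k)) n"
proof -
  have "F 0 \<in> carrier_mat d d" using assms by simp
  then have "mat_prod d F 1 = F 0" by simp
  then show ?thesis using mat_prod_add[of 1 n F d] assms by (simp del: mat_prod.simps)
qed

text \<open>Products over whole periods are powers of the product over one period.\<close>

lemma mat_prod_periodic:
  assumes F: "\<And>k. F k \<in> carrier_mat d d" and per: "\<And>k. F (k + m) = F k"
  shows "mat_prod d F (m * j) = mat_prod d F m ^\<^sub>m j"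
proof (induction j)
  case 0
  have "mat_prod d F m \<in> carrier_mat d d" using F by (intro mat_prod_carrier)
  then show ?case by simp
next
  case (Suc j)
  have "F (m * j + k) = F k" for k
    by (induction j) (auto simp: per algebra_simps, metis add.assoc add.commute per)
  then show ?case using mat_prod_add[of "m * j" m F d] F Suc by (simp add: add.commute)
qed

section \<open>Entrywise nonnegative matrices and sums of entries\<close>

text \<open>Nonnegativity is meant entrywise; \<open>vec_sum\<close> is the \<open>\<ell>\<^sup>1\<close> norm on nonnegative vectors.\<close>

definition mat_nonneg :: "real mat \<Rightarrow> bool" where
  "mat_nonneg A \<longleftrightarrow> (\<forall>i<dim_row A. \<forall>j<dim_col A. 0 \<le> A $$ (i, j))"

definition vec_nonneg :: "real vec \<Rightarrow> bool" where
  "vec_nonneg x \<longleftrightarrow> (\<forall>i<dim_vec x. 0 \<le> x $ i)"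

definition vec_sum :: "real vec \<Rightarrow> real" where
  "vec_sum x = (\<Sum>i<dim_vec x. x $ i)"

lemma vec_sum_carrier: "x \<in> carrier_vec n \<Longrightarrow> vec_sum x = (\<Sum>i<n. x $ i)"
  by (auto simp: vec_sum_def)

lemma sum_mat_carrier:
  "A \<in> carrier_mat n m \<Longrightarrow> sum_mat A = (\<Sum>i<n. \<Sum>j<m. A $$ (i, j))"
  by (auto simp: sum_mat_def sum.cartesian_product atLeast0LessThan)

lemma mult_mat_index:
  assumes "A \<in> carrier_mat n m" "B \<in> carrier_mat m l" "i < n" "j < l"
  shows "(A * B) $$ (i, j) = (\<Sum>k<m. A $$ (i, k) * B $$ (k, j))"
  using assms by (auto simp: scalar_prod_def atLeast0LessThan)

lemma mult_mat_vec_index: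
  assumes "A \<in> carrier_mat n m" "x \<in> carrier_vec m" "i < n"
  shows "(A *\<^sub>v x) $ i = (\<Sum>k<m. A $$ (i, k) * x $ k)"
  using assms by (auto simp: scalar_prod_def atLeast0LessThan)

lemma mat_nonneg_mult:
  assumes "A \<in> carrier_mat n m" "B \<in> carrier_mat m l" "mat_nonneg A" "mat_nonneg B"
  shows "mat_nonneg (A * B)"
  unfolding mat_nonneg_def
proof (intro allI impI)
  fix i j assume "i < dim_row (A * B)" "j < dim_col (A * B)"
  then have ij: "i < n" "j < l" using assms by auto
  show "0 \<le> (A * B) $$ (i, j)"
    unfolding mult_mat_index[OF assms(1,2) ij]
    using assms ij by (intro sum_nonneg mult_nonneg_nonneg) (auto simp: mat_nonneg_def)
qed

lemma mat_nonneg_one: "mat_nonneg (1\<^sub>m n)"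
  by (auto simp: mat_nonneg_def)

lemma mat_nonneg_mat_prod:
  assumes "\<And>k. F k \<in> carrier_mat d d" "\<And>k. mat_nonneg (F k)"
  shows "mat_nonneg (mat_prod d F n)"
proof (induction n)
  case (Suc n)
  then show ?case using assms mat_prod_carrier[of n F d]
    by (auto intro: mat_nonneg_mult[of _ d d _ d])
qed (simp add: mat_nonneg_one)

lemma vec_nonneg_mult:
  assumes "A \<in> carrier_mat n m" "x \<in> carrier_vec m" "mat_nonneg A" "vec_nonneg x"
  shows "vec_nonneg (A *\<^sub>v x)"
  unfolding vec_nonneg_def
proof (intro allI impI)
  fix i assume "i < dim_vec (A *\<^sub>v x)"
  then have i: "i < n" using assms by auto
  show "0 \<le> (A *\<^sub>v x) $ i"
    unfolding mult_mat_vec_index[OF assms(1,2) i]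
    using assms i by (intro sum_nonneg mult_nonneg_nonneg) (auto simp: mat_nonneg_def vec_nonneg_def)
qed

lemma sum_mat_nonneg: "mat_nonneg A \<Longrightarrow> 0 \<le> sum_mat A"
  by (auto simp: sum_mat_def mat_nonneg_def intro!: sum_nonneg)

lemma vec_sum_nonneg: "vec_nonneg x \<Longrightarrow> 0 \<le> vec_sum x"
  by (auto simp: vec_sum_def vec_nonneg_def intro!: sum_nonneg)

lemma entry_le_sum_mat:
  assumes "mat_nonneg A" "i < dim_row A" "j < dim_col A"
  shows "A $$ (i, j) \<le> sum_mat A"
  unfolding sum_mat_def using assms
  by (intro member_le_sum[of "(i, j)" _ "\<lambda>ij. A $$ ij"]) (auto simp: mat_nonneg_def)

lemma entry_le_vec_sum:
  assumes "vec_nonneg x" "i < dim_vec x"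
  shows "x $ i \<le> vec_sum x"
  unfolding vec_sum_def using assms
  by (intro member_le_sum[of i _ "\<lambda>i. x $ i"]) (auto simp: vec_nonneg_def)

lemma vec_sum_mult:
  assumes "A \<in> carrier_mat n m" "x \<in> carrier_vec m"
  shows "vec_sum (A *\<^sub>v x) = (\<Sum>i<n. \<Sum>k<m. A $$ (i, k) * x $ k)"
  using assms by (subst vec_sum_carrier[of _ n]) (auto simp del: index_mult_mat_vec
      simp: mult_mat_vec_index[of A n m])

lemma vec_sum_add:
  assumes "x \<in> carrier_vec n" "y \<in> carrier_vec n"
  shows "vec_sum (x + y) = vec_sum x + vec_sum y"
  using assms by (auto simp: vec_sum_def sum.distrib)

lemma vec_sum_mult_le:
  assumes A: "A \<in> carrier_mat n m" "mat_nonneg A" and x: "x \<in> carrier_vec m" "vec_nonneg x"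
  shows "vec_sum (A *\<^sub>v x) \<le> sum_mat A * vec_sum x"
proof -
  have "vec_sum (A *\<^sub>v x) = (\<Sum>i<n. \<Sum>k<m. A $$ (i, k) * x $ k)"
    by (rule vec_sum_mult[OF A(1) x(1)])
  also have "\<dots> \<le> (\<Sum>i<n. \<Sum>k<m. A $$ (i, k) * vec_sum x)"
    using A x by (intro sum_mono mult_left_mono entry_le_vec_sum) (auto simp: mat_nonneg_def)
  also have "\<dots> = sum_mat A * vec_sum x"
    by (simp add: sum_mat_carrier[OF A(1)] sum_distrib_right)
  finally show ?thesis .
qed

lemma sum_mat_mult_le:
  assumes A: "A \<in> carrier_mat n m" "mat_nonneg A" and B: "B \<in> carrier_mat m l" "mat_nonneg B"
  shows "sum_mat (A * B) \<le> sum_mat A * sum_mat B"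
proof -
  have "sum_mat (A * B) = (\<Sum>i<n. \<Sum>j<l. \<Sum>k<m. A $$ (i, k) * B $$ (k, j))"
    using A B by (subst sum_mat_carrier[of _ n l]) (auto simp del: index_mult_mat(1)
      simp: mult_mat_index[of A n m])
  also have "\<dots> = (\<Sum>i<n. \<Sum>k<m. A $$ (i, k) * (\<Sum>j<l. B $$ (k, j)))"
    unfolding sum_distrib_left by (intro sum.cong refl sum.swap)
  also have "\<dots> \<le> (\<Sum>i<n. \<Sum>k<m. A $$ (i, k) * sum_mat B)"
  proof (intro sum_mono mult_left_mono)
    fix k assume k: "k \<in> {..<m}"
    show "(\<Sum>j<l. B $$ (k, j)) \<le> sum_mat B"
      unfolding sum_mat_carrier[OF B(1)] using B k
      by (intro member_le_sum[of k _ "\<lambda>k. \<Sum>j<l. B $$ (k, j)"])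
         (auto simp: mat_nonneg_def intro!: sum_nonneg)
  qed (use A in \<open>auto simp: mat_nonneg_def\<close>)
  also have "\<dots> = sum_mat A * sum_mat B"
    by (simp add: sum_mat_carrier[OF A(1)] sum_distrib_right)
  finally show ?thesis .
qed

section \<open>Kronecker powers\<close>

lemma kron_carrier:
  "A \<in> carrier_mat n m \<Longrightarrow> B \<in> carrier_mat k l \<Longrightarrow> kron A B \<in> carrier_mat (n * k) (m * l)"
  by (auto simp: kron_def)

lemma kron_pow_carrier: "A \<in> carrier_mat n m \<Longrightarrow> kron_pow A r \<in> carrier_mat (n ^ r) (m ^ r)"
  by (induction r) (auto intro: kron_carrier)

lemma div_less_of_less_mult: "(i::nat) < n * k \<Longrightarrow> i div k < n"
  by (simp add: less_mult_imp_div_less)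

lemma mod_less_of_less_mult: "(i::nat) < n * k \<Longrightarrow> i mod k < k"
  by (cases k) auto

text \<open>The mixed-product property.\<close>

lemma kron_mult:
  fixes A B C D :: "'a :: comm_semiring_0 mat"
  assumes A: "A \<in> carrier_mat n1 n2" and B: "B \<in> carrier_mat k1 k2"
    and C: "C \<in> carrier_mat n2 n3" and D: "D \<in> carrier_mat k2 k3"
  shows "kron A B * kron C D = kron (A * C) (B * D)"
proof (rule eq_matI)
  fix i j assume "i < dim_row (kron (A * C) (B * D))" "j < dim_col (kron (A * C) (B * D))"
  then have i: "i < n1 * k1" and j: "j < n3 * k3" using assms by (auto simp: kron_def)
  note dm = div_less_of_less_mult[OF i] div_less_of_less_mult[OF j]
    mod_less_of_less_mult[OF i] mod_less_of_less_mult[OF j]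
  have "(kron A B * kron C D) $$ (i, j) = (\<Sum>l<n2 * k2. kron A B $$ (i, l) * kron C D $$ (l, j))"
    using assms i j by (simp add: scalar_prod_def atLeast0LessThan kron_def)
  also have "\<dots> = (\<Sum>a<n2. \<Sum>b<k2. kron A B $$ (i, b + a * k2) * kron C D $$ (b + a * k2, j))"
    by (rule sum_mult_product)
  also have "\<dots> = (\<Sum>a<n2. \<Sum>b<k2. (A $$ (i div k1, a) * C $$ (a, j div k3)) *
      (B $$ (i mod k1, b) * D $$ (b, j mod k3)))"
  proof (intro sum.cong refl)
    fix a b assume ab: "a \<in> {..<n2}" "b \<in> {..<k2}"
    have "b + a * k2 < k2 + a * k2" using ab by simp
    also have "\<dots> \<le> n2 * k2" using ab by (metis Suc_leI lessThan_iff mult_Suc mult_le_mono1)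
    finally show "kron A B $$ (i, b + a * k2) * kron C D $$ (b + a * k2, j) =
        (A $$ (i div k1, a) * C $$ (a, j div k3)) * (B $$ (i mod k1, b) * D $$ (b, j mod k3))"
      using assms i j ab by (simp add: kron_def ac_simps)
  qed
  also have "\<dots> = (\<Sum>a<n2. A $$ (i div k1, a) * C $$ (a, j div k3)) *
      (\<Sum>b<k2. B $$ (i mod k1, b) * D $$ (b, j mod k3))"
    by (simp add: sum_product)
  also have "\<dots> = kron (A * C) (B * D) $$ (i, j)"
    using assms i j dm by (simp add: kron_def scalar_prod_def atLeast0LessThan)
  finally show "(kron A B * kron C D) $$ (i, j) = kron (A * C) (B * D) $$ (i, j)" .
qed (use assms in \<open>auto simp: kron_def\<close>)

lemma kron_pow_mult:
  fixes A B :: "'a :: comm_semiring_1 mat"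
  assumes "A \<in> carrier_mat n m" "B \<in> carrier_mat m l"
  shows "kron_pow (A * B) r = kron_pow A r * kron_pow B r"
proof (induction r)
  case (Suc r)
  show ?case
    using kron_mult[OF assms(1) kron_pow_carrier[OF assms(1), of r] assms(2)
        kron_pow_carrier[OF assms(2), of r]] Suc by simp
qed simp

lemma kron_pow_one: "kron_pow (1\<^sub>m n :: 'a :: comm_semiring_1 mat) r = 1\<^sub>m (n ^ r)"
proof (induction r)
  case (Suc r)
  show ?case
  proof (rule eq_matI)
    fix i j assume "i < dim_row (1\<^sub>m (n ^ Suc r) :: 'a mat)" "j < dim_col (1\<^sub>m (n ^ Suc r) :: 'a mat)"
    then have ij: "i < n * n ^ r" "j < n * n ^ r" by auto
    have "i = j \<longleftrightarrow> i div n ^ r = j div n ^ r \<and> i mod n ^ r = j mod n ^ r"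
      by (metis div_mult_mod_eq)
    then show "kron_pow (1\<^sub>m n :: 'a mat) (Suc r) $$ (i, j) = 1\<^sub>m (n ^ Suc r) $$ (i, j)"
      using Suc ij div_less_of_less_mult[OF ij(1)] div_less_of_less_mult[OF ij(2)]
        mod_less_of_less_mult[OF ij(1)] mod_less_of_less_mult[OF ij(2)]
      by (simp add: kron_def)
  qed (use Suc in \<open>auto simp: kron_def\<close>)
qed simp

lemma mat_nonneg_kron:
  assumes "mat_nonneg A" "mat_nonneg B"
  shows "mat_nonneg (kron A B)"
  using assms unfolding mat_nonneg_def
  by (auto simp: kron_def div_less_of_less_mult mod_less_of_less_mult)

lemma mat_nonneg_kron_pow: "mat_nonneg A \<Longrightarrow> mat_nonneg (kron_pow A r)"
  by (induction r) (auto intro: mat_nonneg_kron mat_nonneg_one)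

lemma sum_mat_kron: "sum_mat (kron A B) = sum_mat A * sum_mat (B :: real mat)"
proof -
  obtain n m k l where A: "A \<in> carrier_mat n m" and B: "B \<in> carrier_mat k l"
    by (metis carrier_mat_triv)
  have "sum_mat (kron A B) = (\<Sum>i<n * k. \<Sum>j<m * l. kron A B $$ (i, j))"
    by (rule sum_mat_carrier[OF kron_carrier[OF A B]])
  also have "\<dots> = (\<Sum>a<n. \<Sum>b<k. \<Sum>a'<m. \<Sum>b'<l. kron A B $$ (b + a * k, b' + a' * l))"
    by (simp only: sum_mult_product)
  also have "\<dots> = (\<Sum>a<n. \<Sum>b<k. \<Sum>a'<m. \<Sum>b'<l. A $$ (a, a') * B $$ (b, b'))"
  proof (intro sum.cong refl)
    fix a b a' b' assume *: "a \<in> {..<n}" "b \<in> {..<k}" "a' \<in> {..<m}" "b' \<in> {..<l}"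
    have "b + a * k < k + a * k" using * by simp
    also have "\<dots> \<le> n * k" using * by (metis Suc_leI lessThan_iff mult_Suc mult_le_mono1)
    finally have 1: "b + a * k < n * k" .
    have "b' + a' * l < l + a' * l" using * by simp
    also have "\<dots> \<le> m * l" using * by (metis Suc_leI lessThan_iff mult_Suc mult_le_mono1)
    finally have 2: "b' + a' * l < m * l" .
    show "kron A B $$ (b + a * k, b' + a' * l) = A $$ (a, a') * B $$ (b, b')"
      using A B * 1 2 by (simp add: kron_def)
  qed
  also have "\<dots> = (\<Sum>a<n. \<Sum>a'<m. \<Sum>b<k. \<Sum>b'<l. A $$ (a, a') * B $$ (b, b'))"
    by (intro sum.cong refl sum.swap)
  also have "\<dots> = sum_mat A * sum_mat B"
    unfolding sum_mat_carrier[OF A] sum_mat_carrier[OF B]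
    by (simp add: sum_distrib_left[symmetric] sum_distrib_right)
  finally show ?thesis .
qed

lemma sum_mat_kron_pow: "sum_mat (kron_pow A r) = (sum_mat A :: real) ^ r"
  by (induction r) (auto simp: sum_mat_kron sum_mat_carrier[of _ 1 1])

lemma add_mult_div_self: "(I::nat) < N \<Longrightarrow> (I + i * N) div N = i"
  by simp

text \<open>The pure powers of the coordinates of \<open>x\<close> are among the coordinates of its Kronecker power.\<close>

lemma kron_pow_col_mat_diag:
  assumes i: "i < n"
  shows "\<exists>I<n ^ r. \<forall>x\<in>carrier_vec n. kron_pow (col_mat x) r $$ (I, 0) = (x $ i :: real) ^ r"
proof (induction r)
  case (Suc r)
  then obtain I where I: "I < n ^ r"
    and eq: "\<And>x :: real vec. x \<in> carrier_vec n \<Longrightarrow> kron_pow (col_mat x) r $$ (I, 0) = (x $ i) ^ r"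
    by blast
  have "I + i * n ^ r < n ^ r + i * n ^ r" using I by simp
  also have "\<dots> \<le> n * n ^ r" using i by (metis Suc_leI mult_Suc mult_le_mono1)
  finally have lt: "I + i * n ^ r < n * n ^ r" .
  have "kron_pow (col_mat x) (Suc r) $$ (I + i * n ^ r, 0) = (x $ i) ^ Suc r"
    if x: "x \<in> carrier_vec n" for x :: "real vec"
  proof -
    have C: "col_mat x \<in> carrier_mat n 1" using x by (auto simp: col_mat_def mat_of_cols_def)
    have K: "kron_pow (col_mat x) r \<in> carrier_mat (n ^ r) 1" using kron_pow_carrier[OF C, of r] by simp
    have "(I + i * n ^ r) div n ^ r = i" using I by (rule add_mult_div_self)
    then have "kron_pow (col_mat x) (Suc r) $$ (I + i * n ^ r, 0) = col_mat x $$ (i, 0) * (x $ i) ^ r"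
      using C K lt I eq[OF x] by (simp add: kron_def)
    also have "col_mat x $$ (i, 0) = x $ i" using x i by (simp add: col_mat_def mat_of_cols_def)
    finally show ?thesis by simp
  qed
  then show ?case using lt by (intro exI[of _ "I + i * n ^ r"]) simp
qed auto

section \<open>Spectral radius and growth of matrix powers\<close>

lemma map_mat_of_real_pow:
  assumes "A \<in> carrier_mat n n"
  shows "map_mat complex_of_real A ^\<^sub>m k = map_mat complex_of_real (A ^\<^sub>m k)"
  using of_real_hom.mat_hom_pow[OF assms] by metis

text \<open>
  Powers of a matrix of spectral radius below one are bounded. Applied to \<open>(1 / l) A\<close> with
  \<open>l\<close> strictly between the spectral radius of \<open>A\<close> and one, this gives geometric decay.
\<close>

lemma spectral_radius_less_1_decay:
  fixes A :: "real mat"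
  assumes A: "A \<in> carrier_mat n n" and n: "n > 0"
    and rho: "real_spectral_radius A < 1"
  shows "\<exists>C l. 0 < l \<and> l < 1 \<and> (\<forall>k. sum_mat (A ^\<^sub>m k) \<le> C * l ^ k)"
proof -
  define A' where "A' = map_mat complex_of_real A"
  have A': "A' \<in> carrier_mat n n" using A by (simp add: A'_def)
  have rho': "spectral_radius A' < 1" using rho by (simp add: A'_def real_spectral_radius_def)
  have rho0: "spectral_radius A' \<ge> 0" using spectral_radius_mem_max(1)[OF A' n] by auto
  define l where "l = (1 + spectral_radius A') / 2"
  have l: "0 < l" "l < 1" "spectral_radius A' < l" using rho' rho0 by (auto simp: l_def)
  define S where "S = complex_of_real (1 / l) \<cdot>\<^sub>m A'"
  have S: "S \<in> carrier_mat n n" using A' by (simp add: S_def)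
  have "spectral_radius S < 1"
  proof -
    obtain e where e: "e \<in> spectrum S" "spectral_radius S = norm e"
      using spectral_radius_mem_max(1)[OF S n] by auto
    then obtain v where v: "v \<in> carrier_vec n" "v \<noteq> 0\<^sub>v n" "S *\<^sub>v v = e \<cdot>\<^sub>v v"
      using S by (auto simp: spectrum_def eigenvalue_def eigenvector_def)
    have "A' *\<^sub>v v = complex_of_real l \<cdot>\<^sub>v (S *\<^sub>v v)"
    proof (rule eq_vecI)
      fix i assume "i < dim_vec (complex_of_real l \<cdot>\<^sub>v (S *\<^sub>v v))"
      then have i: "i < n" using S by simp
      show "(A' *\<^sub>v v) $ i = (complex_of_real l \<cdot>\<^sub>v (S *\<^sub>v v)) $ i"
        using A' v(1) l i S by (simp add: S_def scalar_prod_def sum_distrib_left)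
    qed (use A' S in auto)
    also have "\<dots> = (of_real l * e) \<cdot>\<^sub>v v" using v by (simp add: smult_smult_assoc)
    finally have "of_real l * e \<in> spectrum A'"
      using A' v by (auto simp: spectrum_def eigenvalue_def eigenvector_def)
    then have "norm (of_real l * e) \<le> spectral_radius A'"
      by (intro spectral_radius_mem_max(2)[OF A' n]) auto
    then have "l * norm e \<le> spectral_radius A'" using l by (simp add: norm_mult)
    then have "l * norm e < l * 1" using l by linarith
    then show ?thesis using l(1) e(2) mult_less_cancel_left_pos by metis
  qed
  from spectral_radius_jnf_norm_bound_less_1_upper_triangular[OF S this]
  obtain c where c: "\<And>k. norm_bound (S ^\<^sub>m k) c" by auto
  have Sk: "S ^\<^sub>m k = complex_of_real ((1 / l) ^ k) \<cdot>\<^sub>m map_mat complex_of_real (A ^\<^sub>m k)" for k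
  proof (induction k)
    case 0
    then show ?case using A S by (intro eq_matI) auto
  next
    case (Suc k)
    have Ak: "map_mat complex_of_real (A ^\<^sub>m k) \<in> carrier_mat n n" using A by simp
    have eq: "map_mat complex_of_real (A ^\<^sub>m Suc k) = map_mat complex_of_real (A ^\<^sub>m k) * A'"
      using map_mat_of_real_pow[OF A, of "Suc k"] map_mat_of_real_pow[OF A, of k]
      by (simp add: A'_def)
    have "S ^\<^sub>m Suc k = (complex_of_real ((1 / l) ^ k) \<cdot>\<^sub>m map_mat complex_of_real (A ^\<^sub>m k)) *
        (complex_of_real (1 / l) \<cdot>\<^sub>m A')"
      unfolding pow_mat.simps Suc by (simp only: S_def)
    also have "\<dots> = complex_of_real ((1 / l) ^ Suc k) \<cdot>\<^sub>m (map_mat complex_of_real (A ^\<^sub>m k) * A')"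
      using Ak A' by (intro eq_matI) (auto simp: mult_ac)
    finally show ?case unfolding eq .
  qed
  have entry: "(A ^\<^sub>m k) $$ (i, j) \<le> c * l ^ k" if "i < n" "j < n" for i j k
  proof -
    have Ak: "A ^\<^sub>m k \<in> carrier_mat n n" using A by simp
    have "norm ((S ^\<^sub>m k) $$ (i, j)) \<le> c"
      using c[of k] that carrier_matD[OF pow_carrier_mat[OF S]] unfolding norm_bound_def by metis
    moreover have "(S ^\<^sub>m k) $$ (i, j) = complex_of_real ((1 / l) ^ k * (A ^\<^sub>m k) $$ (i, j))"
      unfolding Sk using that A by simp
    ultimately have "(1 / l) ^ k * \<bar>(A ^\<^sub>m k) $$ (i, j)\<bar> \<le> c"
      using l by (simp only: norm_of_real abs_mult) simp
    then have "\<bar>(A ^\<^sub>m k) $$ (i, j)\<bar> \<le> c * l ^ k"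
      using l by (simp add: power_one_over divide_simps)
    then show ?thesis by linarith
  qed
  have "sum_mat (A ^\<^sub>m k) \<le> (n * n * c) * l ^ k" for k
  proof -
    have "sum_mat (A ^\<^sub>m k) \<le> (\<Sum>i<n. \<Sum>j<n. c * l ^ k)"
      unfolding sum_mat_carrier[OF pow_carrier_mat[OF A]] by (intro sum_mono entry) auto
    then show ?thesis by (simp add: algebra_simps)
  qed
  then show ?thesis using l by blast
qed

text \<open>
  The converse needs the powers along an arithmetic progression only: an eigenvector \<open>v\<close> for an
  eigenvalue of modulus at least one satisfies \<open>|v\<^sub>i| \<le> |(A\<^sup>k v)\<^sub>i|\<close>.
\<close>

lemma powers_tendsto_0_imp_spectral_radius_less_1:
  fixes A :: "real mat"
  assumes A: "A \<in> carrier_mat n n" and n: "n > 0" and nn: "mat_nonneg A"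
    and lim: "(\<lambda>j. sum_mat (A ^\<^sub>m (m * j))) \<longlonglongrightarrow> 0"
  shows "real_spectral_radius A < 1"
proof (rule ccontr)
  assume "\<not> ?thesis"
  define A' where "A' = map_mat complex_of_real A"
  have A': "A' \<in> carrier_mat n n" using A by (simp add: A'_def)
  obtain e where e: "e \<in> spectrum A'" "spectral_radius A' = norm e"
    using spectral_radius_mem_max(1)[OF A' n] by auto
  with \<open>\<not> ?thesis\<close> have e1: "norm e \<ge> 1" by (simp add: A'_def real_spectral_radius_def)
  obtain v where ev: "eigenvector A' v e" using e by (auto simp: spectrum_def eigenvalue_def)
  then have v: "v \<in> carrier_vec n" "v \<noteq> 0\<^sub>v n" using A' by (auto simp: eigenvector_def)
  then obtain i where i: "i < n" "v $ i \<noteq> 0" by (metis carrier_vecD eq_vecI index_zero_vec)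
  define V where "V = (\<Sum>k<n. norm (v $ k))"
  have nnk: "mat_nonneg (A ^\<^sub>m k)" for k
  proof (induction k)
    case (Suc k)
    then show ?case using A nn by (auto intro: mat_nonneg_mult[of _ n n _ n])
  qed (use A in \<open>simp add: mat_nonneg_one\<close>)
  have bound: "norm (v $ i) \<le> sum_mat (A ^\<^sub>m k) * V" for k
  proof -
    have Ak: "A ^\<^sub>m k \<in> carrier_mat n n" using A by simp
    have "norm (v $ i) \<le> norm e ^ k * norm (v $ i)"
      using e1 one_le_power[of "norm e" k] by (simp add: mult_le_cancel_right1)
    also have "\<dots> = norm ((A' ^\<^sub>m k *\<^sub>v v) $ i)"
      using eigenvector_pow[OF A' ev, of k] v i by (simp add: norm_mult norm_power)
    also have "\<dots> = norm (\<Sum>j<n. complex_of_real ((A ^\<^sub>m k) $$ (i, j)) * v $ j)"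
      using mult_mat_vec_index[of "A' ^\<^sub>m k" n n v i] A' v i Ak
      by (simp add: A'_def map_mat_of_real_pow[OF A] scalar_prod_def atLeast0LessThan)
    also have "\<dots> \<le> (\<Sum>j<n. norm (complex_of_real ((A ^\<^sub>m k) $$ (i, j)) * v $ j))"
      by (rule norm_sum)
    also have "\<dots> \<le> (\<Sum>j<n. sum_mat (A ^\<^sub>m k) * norm (v $ j))"
    proof (intro sum_mono)
      fix j assume j: "j \<in> {..<n}"
      have "0 \<le> (A ^\<^sub>m k) $$ (i, j)" "(A ^\<^sub>m k) $$ (i, j) \<le> sum_mat (A ^\<^sub>m k)"
        using nnk[of k] Ak i j entry_le_sum_mat[OF nnk[of k], of i j]
        unfolding mat_nonneg_def by (metis carrier_matD lessThan_iff)+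
      then have j0: "\<bar>(A ^\<^sub>m k) $$ (i, j)\<bar> \<le> sum_mat (A ^\<^sub>m k)" by simp
      show "norm (complex_of_real ((A ^\<^sub>m k) $$ (i, j)) * v $ j) \<le> sum_mat (A ^\<^sub>m k) * norm (v $ j)"
        using j0 by (simp add: norm_mult mult_right_mono)
    qed
    finally show ?thesis by (simp add: V_def sum_distrib_left)
  qed
  have "(\<lambda>j. sum_mat (A ^\<^sub>m (m * j)) * V) \<longlonglongrightarrow> 0 * V" by (intro tendsto_intros lim)
  then have "norm (v $ i) \<le> 0 * V"
    by (rule LIMSEQ_le_const) (use bound in auto)
  then show False using i by simp
qed

section \<open>Powers of sums\<close>

text \<open>
  A substitute for the triangle inequality of the \<open>L\<^sup>r\<close> norm that is linear in the powers
  \<open>x\<^sub>k\<^sup>r\<close>, at the price of geometric weights: every \<open>x\<^sub>k\<close> is at most \<open>q\<^sup>k\<close> times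
  the \<open>r\<close>-th root of the sum on the right.
\<close>

lemma sum_power_le_geometric:
  fixes x :: "nat \<Rightarrow> real"
  assumes x: "\<And>k. 0 \<le> x k" and q: "0 < q" "q < 1" and r: "r > 0"
  shows "(\<Sum>k<n. x k) ^ r \<le> (1 / (1 - q)) ^ r * (\<Sum>k<n. (x k / q ^ k) ^ r)"
proof -
  define T where "T = (\<Sum>k<n. (x k / q ^ k) ^ r)"
  have T0: "0 \<le> T" unfolding T_def using x q by (intro sum_nonneg) simp
  have le: "x k \<le> root r T * q ^ k" if "k < n" for k
  proof -
    have "(x k / q ^ k) ^ r \<le> T"
      unfolding T_def using that x q
      by (intro member_le_sum[of k _ "\<lambda>k. (x k / q ^ k) ^ r"]) simp_all
    then have "root r ((x k / q ^ k) ^ r) \<le> root r T" using r by simp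
    then have "x k / q ^ k \<le> root r T" using r x q by (simp add: real_root_power_cancel)
    then show ?thesis using q by (simp add: field_simps)
  qed
  have geo: "(\<Sum>k<n. q ^ k) \<le> 1 / (1 - q)"
    using q by (simp add: sum_gp_strict field_simps)
  have "(\<Sum>k<n. x k) \<le> (\<Sum>k<n. root r T * q ^ k)" using le by (intro sum_mono) auto
  also have "\<dots> = root r T * (\<Sum>k<n. q ^ k)" by (simp add: sum_distrib_left)
  also have "\<dots> \<le> root r T * (1 / (1 - q))"
    using geo T0 r by (intro mult_left_mono) auto
  finally have "(\<Sum>k<n. x k) ^ r \<le> (root r T * (1 / (1 - q))) ^ r"
    using x by (intro power_mono sum_nonneg) auto
  also have "\<dots> = (1 / (1 - q)) ^ r * T"
    unfolding power_mult_distrib using T0 r by simp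
  finally show ?thesis by (simp add: T_def)
qed

lemma sum_power_le_power_sum:
  fixes x :: "nat \<Rightarrow> real"
  assumes x: "\<And>k. 0 \<le> x k" and r: "r > 0"
  shows "(\<Sum>k<n. x k ^ r) \<le> (\<Sum>k<n. x k) ^ r"
proof (induction n)
  case 0
  then show ?case using r by simp
next
  case (Suc n)
  define s where "s = (\<Sum>k<n. x k)"
  have s: "0 \<le> s" unfolding s_def using x by (intro sum_nonneg) auto
  obtain r' where r': "r = Suc r'" using r by (cases r) auto
  have "s ^ r + x n ^ r = s * s ^ r' + x n * x n ^ r'" by (simp add: r')
  also have "\<dots> \<le> s * (s + x n) ^ r' + x n * (s + x n) ^ r'"
    using s x[of n] by (intro add_mono mult_left_mono power_mono) auto
  also have "\<dots> = (s + x n) ^ r" by (simp add: r' algebra_simps)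
  finally show ?case using Suc by (simp add: s_def)
qed

lemma power_add_le:
  fixes a b :: real
  assumes "0 \<le> a" "0 \<le> b"
  shows "(a + b) ^ r \<le> 2 ^ r * (a ^ r + b ^ r)"
proof -
  have "(a + b) ^ r \<le> (2 * max a b) ^ r" using assms by (intro power_mono) auto
  also have "\<dots> = 2 ^ r * max a b ^ r" by (simp add: power_mult_distrib)
  also have "max a b ^ r \<le> a ^ r + b ^ r" using assms by (auto simp: max_def)
  finally show ?thesis by simp
qed

section \<open>Measurability of Kronecker powers and sums in the extended reals\<close>

lemma borel_measurable_kron_pow:
  fixes F :: "'a \<Rightarrow> real mat"
  assumes F: "\<And>x. F x \<in> carrier_mat n m"
    and meas: "\<And>i j. i < n \<Longrightarrow> j < m \<Longrightarrow> (\<lambda>x. F x $$ (i, j)) \<in> borel_measurable N"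
  shows "I < n ^ r \<Longrightarrow> J < m ^ r \<Longrightarrow> (\<lambda>x. kron_pow (F x) r $$ (I, J)) \<in> borel_measurable N"
proof (induction r arbitrary: I J)
  case (Suc r)
  then have IJ: "I < n * n ^ r" "J < m * m ^ r" by auto
  have "(\<lambda>x. kron_pow (F x) (Suc r) $$ (I, J)) = (\<lambda>x. F x $$ (I div n ^ r, J div m ^ r) *
      kron_pow (F x) r $$ (I mod n ^ r, J mod m ^ r))"
  proof
    fix x
    have "kron_pow (F x) r \<in> carrier_mat (n ^ r) (m ^ r)" by (rule kron_pow_carrier[OF F])
    with F[of x] IJ show "kron_pow (F x) (Suc r) $$ (I, J) = F x $$ (I div n ^ r, J div m ^ r) *
      kron_pow (F x) r $$ (I mod n ^ r, J mod m ^ r)" by (simp add: kron_def)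
  qed
  also have "\<dots> \<in> borel_measurable N"
    using IJ by (intro borel_measurable_times meas Suc.IH div_less_of_less_mult mod_less_of_less_mult)
  finally show ?case .
qed auto

lemma ennreal_sum_sum:
  assumes "\<And>i j. i < n \<Longrightarrow> j < m \<Longrightarrow> 0 \<le> f i j"
  shows "ennreal (\<Sum>i<n. \<Sum>j<m. f i j) = (\<Sum>i<n. \<Sum>j<m. ennreal (f i j))"
proof -
  have "ennreal (\<Sum>i<n. \<Sum>j<m. f i j) = (\<Sum>i<n. ennreal (\<Sum>j<m. f i j))"
    using assms by (intro sum_ennreal[symmetric] sum_nonneg) auto
  also have "\<dots> = (\<Sum>i<n. \<Sum>j<m. ennreal (f i j))"
    using assms by (intro sum.cong refl sum_ennreal[symmetric]) auto
  finally show ?thesis .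
qed

section \<open>Random affine recursions with nonnegative periodic coefficients\<close>

text \<open>
  The recursion \<open>u\<^sub>t = G t (\<epsilon>\<^sub>t) u\<^sub>t\<^sub>-\<^sub>1 + B t (\<epsilon>\<^sub>t)\<close> in \<open>d\<close> dimensions with independent
  identically distributed \<open>\<epsilon>\<^sub>t\<close>. The coefficients are \<open>s\<close>-periodic in time, nonnegative, and of at
  most quadratic growth in the innovation, with a moment of order \<open>2r\<close> to match.
\<close>

locale nonneg_affine_recursion = prob_space M for M :: "'w measure" +
  fixes d r s :: nat and \<epsilon> :: "int \<Rightarrow> 'w \<Rightarrow> real"
    and G :: "int \<Rightarrow> real \<Rightarrow> real mat" and B :: "int \<Rightarrow> real \<Rightarrow> real vec" and c :: real
  assumes d_pos: "d > 0" and r_pos: "r > 0" and s_pos: "s > 0"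
    and indep: "indep_vars (\<lambda>_. borel) \<epsilon> UNIV"
    and ident: "distr M borel (\<epsilon> t) = distr M borel (\<epsilon> 0)"
    and G_carrier: "G t x \<in> carrier_mat d d" and G_nonneg: "mat_nonneg (G t x)"
    and G_meas: "i < d \<Longrightarrow> j < d \<Longrightarrow> (\<lambda>x. G t x $$ (i, j)) \<in> borel_measurable borel"
    and G_periodic: "G (t + int s) = G t"
    and G_growth: "sum_mat (G t x) \<le> c * (1 + x\<^sup>2)"
    and B_carrier: "B t x \<in> carrier_vec d" and B_nonneg: "vec_nonneg (B t x)"
    and B_meas: "i < d \<Longrightarrow> (\<lambda>x. B t x $ i) \<in> borel_measurable borel"
    and B_growth: "vec_sum (B t x) \<le> c * (1 + x\<^sup>2)"
    and moment: "integrable M (\<lambda>\<omega>. (1 + (\<epsilon> 0 \<omega>)\<^sup>2) ^ r)"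
begin

text \<open>The random product of the \<open>n\<close> coefficient matrices at the times \<open>t, t - 1, \<dots>, t - n + 1\<close>.\<close>

definition P :: "int \<Rightarrow> nat \<Rightarrow> 'w \<Rightarrow> real mat" where
  "P t n \<omega> = mat_prod d (\<lambda>k. G (t - int k) (\<epsilon> (t - int k) \<omega>)) n"

text \<open>The mean Kronecker power of one coefficient matrix, and the products of these means.\<close>

definition mean :: "int \<Rightarrow> real mat" where
  "mean t = expect_mat M (d ^ r) (d ^ r) (\<lambda>\<omega>. kron_pow (G t (\<epsilon> t \<omega>)) r)"

definition Pmean :: "int \<Rightarrow> nat \<Rightarrow> real mat" where
  "Pmean t n = mat_prod (d ^ r) (\<lambda>k. mean (t - int k)) n"

lemma eps_meas [measurable]: "\<epsilon> t \<in> borel_measurable M"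
  using indep by (auto simp: indep_vars_def)

lemma nn_integral_eps:
  assumes "f \<in> borel_measurable borel"
  shows "(\<integral>\<^sup>+\<omega>. f (\<epsilon> t \<omega>) \<partial>M) = (\<integral>\<^sup>+\<omega>. f (\<epsilon> 0 \<omega>) \<partial>M)"
proof -
  have "f \<in> borel_measurable (distr M borel (\<epsilon> u))" for u using assms by simp
  from nn_integral_distr[OF eps_meas this] show ?thesis by (metis ident)
qed

lemma nn_integral_prod_eps:
  assumes "finite F" "\<And>t. g t \<in> borel_measurable borel"
  shows "(\<integral>\<^sup>+\<omega>. (\<Prod>t\<in>F. g t (\<epsilon> t \<omega>) :: ennreal) \<partial>M) = (\<Prod>t\<in>F. \<integral>\<^sup>+\<omega>. g t (\<epsilon> t \<omega>) \<partial>M)"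
proof (rule indep_vars_nn_integral[OF assms(1)])
  have "indep_vars (\<lambda>_. borel) \<epsilon> F" by (rule indep_vars_subset[OF indep]) simp
  then show "indep_vars (\<lambda>_. borel) (\<lambda>t \<omega>. g t (\<epsilon> t \<omega>)) F"
    by (rule indep_vars_compose2) (use assms in auto)
qed simp

lemma kron_G_meas:
  assumes "I < d ^ r" "J < d ^ r"
  shows "(\<lambda>x. kron_pow (G t x) r $$ (I, J)) \<in> borel_measurable borel"
  using borel_measurable_kron_pow[of "G t" d d borel I r J] G_carrier G_meas assms by blast

lemma kron_G_nonneg:
  assumes "I < d ^ r" "J < d ^ r"
  shows "0 \<le> kron_pow (G t x) r $$ (I, J)"
  using mat_nonneg_kron_pow[OF G_nonneg[of t x], of r] kron_pow_carrier[OF G_carrier[of t x], of r] assms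
  by (auto simp: mat_nonneg_def)

lemma nn_integral_moment: "(\<integral>\<^sup>+\<omega>. ennreal ((1 + (\<epsilon> t \<omega>)\<^sup>2) ^ r) \<partial>M) < \<infinity>"
proof -
  have "(\<integral>\<^sup>+\<omega>. ennreal ((1 + (\<epsilon> t \<omega>)\<^sup>2) ^ r) \<partial>M) = (\<integral>\<^sup>+\<omega>. ennreal ((1 + (\<epsilon> 0 \<omega>)\<^sup>2) ^ r) \<partial>M)"
    by (rule nn_integral_eps) simp
  also have "\<dots> < \<infinity>"
    using nn_integral_eq_integral[OF moment] by simp
  finally show ?thesis .
qed

lemma mean_entry:
  assumes IJ: "I < d ^ r" "J < d ^ r"
  shows "ennreal (mean t $$ (I, J)) = (\<integral>\<^sup>+\<omega>. ennreal (kron_pow (G t (\<epsilon> t \<omega>)) r $$ (I, J)) \<partial>M)"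
    and "0 \<le> mean t $$ (I, J)"
proof -
  let ?k = "\<lambda>\<omega>. kron_pow (G t (\<epsilon> t \<omega>)) r $$ (I, J)"
  have [measurable]: "?k \<in> borel_measurable M"
    using measurable_compose[OF eps_meas kron_G_meas[OF IJ]] .
  have le: "?k \<omega> \<le> c ^ r * (1 + (\<epsilon> t \<omega>)\<^sup>2) ^ r" for \<omega>
  proof -
    have "?k \<omega> \<le> sum_mat (kron_pow (G t (\<epsilon> t \<omega>)) r)"
      using kron_pow_carrier[OF G_carrier[of t "\<epsilon> t \<omega>"], of r] IJ
      by (intro entry_le_sum_mat mat_nonneg_kron_pow G_nonneg) auto
    also have "\<dots> = sum_mat (G t (\<epsilon> t \<omega>)) ^ r" by (rule sum_mat_kron_pow)
    also have "\<dots> \<le> (c * (1 + (\<epsilon> t \<omega>)\<^sup>2)) ^ r"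
      by (intro power_mono G_growth sum_mat_nonneg G_nonneg)
    finally show ?thesis by (simp add: power_mult_distrib)
  qed
  have "integrable M ?k"
  proof (rule integrableI_bounded)
    have "(\<integral>\<^sup>+\<omega>. ennreal (norm (?k \<omega>)) \<partial>M) \<le> (\<integral>\<^sup>+\<omega>. ennreal \<bar>c ^ r\<bar> * ennreal ((1 + (\<epsilon> t \<omega>)\<^sup>2) ^ r) \<partial>M)"
    proof (intro nn_integral_mono)
      fix \<omega>
      have "norm (?k \<omega>) \<le> c ^ r * (1 + (\<epsilon> t \<omega>)\<^sup>2) ^ r" using le[of \<omega>] kron_G_nonneg[OF IJ] by simp
      also have "\<dots> \<le> \<bar>c ^ r\<bar> * (1 + (\<epsilon> t \<omega>)\<^sup>2) ^ r" by (intro mult_right_mono) auto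
      finally show "ennreal (norm (?k \<omega>)) \<le> ennreal \<bar>c ^ r\<bar> * ennreal ((1 + (\<epsilon> t \<omega>)\<^sup>2) ^ r)"
        by (simp flip: ennreal_mult' add: ennreal_leI)
    qed
    also have "\<dots> < \<infinity>"
      using nn_integral_moment[of t] by (simp add: nn_integral_cmult ennreal_mult_less_top)
    finally show "(\<integral>\<^sup>+\<omega>. ennreal (norm (?k \<omega>)) \<partial>M) < \<infinity>" .
  qed simp
  from nn_integral_eq_integral[OF this] kron_G_nonneg[OF IJ]
  show "ennreal (mean t $$ (I, J)) = (\<integral>\<^sup>+\<omega>. ennreal (?k \<omega>) \<partial>M)"
    using IJ by (simp add: mean_def expect_mat_def)
  show "0 \<le> mean t $$ (I, J)"
    using IJ kron_G_nonneg[OF IJ] by (simp add: mean_def expect_mat_def)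
qed

lemma mean_carrier [simp]: "mean t \<in> carrier_mat (d ^ r) (d ^ r)"
  by (simp add: mean_def expect_mat_def)

lemma mean_nonneg: "mat_nonneg (mean t)"
  using carrier_matD[OF mean_carrier[of t]] mean_entry(2)[of _ _ t] by (auto simp: mat_nonneg_def)

lemma mean_periodic: "mean (t + int s) = mean t"
proof (rule eq_matI)
  fix I J assume "I < dim_row (mean t)" "J < dim_col (mean t)"
  then have IJ: "I < d ^ r" "J < d ^ r" using mean_carrier[of t] by auto
  have m: "(\<lambda>x. ennreal (kron_pow (G t x) r $$ (I, J))) \<in> borel_measurable borel"
    using kron_G_meas[OF IJ, of t] by simp
  have "ennreal (mean (t + int s) $$ (I, J)) = ennreal (mean t $$ (I, J))"
    unfolding mean_entry(1)[OF IJ] G_periodic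
    by (subst (1 2) nn_integral_eps[OF m]) simp
  then show "mean (t + int s) $$ (I, J) = mean t $$ (I, J)"
    using mean_entry(2)[OF IJ] by (simp add: ennreal_inj)
qed (simp_all add: mean_def expect_mat_def)

lemma P_carrier [simp]: "P t n \<omega> \<in> carrier_mat d d"
  unfolding P_def by (intro mat_prod_carrier G_carrier)

lemma P_nonneg: "mat_nonneg (P t n \<omega>)"
  unfolding P_def by (intro mat_nonneg_mat_prod G_carrier G_nonneg)

lemma P_0: "P t 0 \<omega> = 1\<^sub>m d"
  by (simp add: P_def)

lemma P_Suc: "P t (Suc n) \<omega> = P t n \<omega> * G (t - int n) (\<epsilon> (t - int n) \<omega>)"
  by (simp add: P_def)

lemma P_add: "P t (m + n) \<omega> = P t m \<omega> * P (t - int m) n \<omega>"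
  unfolding P_def by (subst mat_prod_add) (auto simp: G_carrier algebra_simps)

lemma P_Suc_left: "P t (Suc n) \<omega> = G t (\<epsilon> t \<omega>) * P (t - 1) n \<omega>"
  unfolding P_def by (subst mat_prod_Suc_left) (auto simp: G_carrier algebra_simps)

lemma Pmean_carrier [simp]: "Pmean t n \<in> carrier_mat (d ^ r) (d ^ r)"
  unfolding Pmean_def by (intro mat_prod_carrier mean_carrier)

lemma Pmean_nonneg: "mat_nonneg (Pmean t n)"
  unfolding Pmean_def by (intro mat_nonneg_mat_prod mean_carrier mean_nonneg)

lemma Pmean_add: "Pmean t (m + n) = Pmean t m * Pmean (t - int m) n"
  unfolding Pmean_def by (subst mat_prod_add) (auto simp: algebra_simps)

lemma Pmean_periodic: "Pmean (t + int s) n = Pmean t n"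
  unfolding Pmean_def
proof (rule mat_prod_cong)
  fix k
  show "mean (t + int s - int k) = mean (t - int k)"
    using mean_periodic[of "t - int k"] by (simp add: algebra_simps)
qed

lemma Pmean_periodic_mult: "Pmean (t + int s * j) n = Pmean t n"
proof -
  have *: "Pmean (t + int s * int k) n = Pmean t n" for t k
  proof (induction k)
    case (Suc k)
    then show ?case using Pmean_periodic[of "t + int s * int k" n] by (simp add: algebra_simps)
  qed simp
  show ?thesis
  proof (cases "j \<ge> 0")
    case True
    then show ?thesis using *[of t "nat j"] by simp
  next
    case False
    then show ?thesis using *[of "t + int s * j" "nat (-j)"] by simp
  qed
qed

lemma Pmean_pow: "Pmean t (s * j) = Pmean t s ^\<^sub>m j"
  unfolding Pmean_def
proof (rule mat_prod_periodic)
  fix k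
  show "mean (t - int (k + s)) = mean (t - int k)"
    using mean_periodic[of "t - int (k + s)"] by (simp add: algebra_simps)
qed simp

lemma P_meas [measurable]:
  assumes "i < d" "j < d"
  shows "(\<lambda>\<omega>. P t n \<omega> $$ (i, j)) \<in> borel_measurable M"
  using assms
proof (induction n arbitrary: j)
  case 0
  then show ?case by (simp add: P_0)
next
  case (Suc n)
  have "(\<lambda>\<omega>. P t (Suc n) \<omega> $$ (i, j)) =
      (\<lambda>\<omega>. \<Sum>k<d. P t n \<omega> $$ (i, k) * G (t - int n) (\<epsilon> (t - int n) \<omega>) $$ (k, j))"
    unfolding P_Suc by (intro ext mult_mat_index[OF P_carrier G_carrier] Suc.prems)
  also have "\<dots> \<in> borel_measurable M"
    using Suc measurable_compose[OF eps_meas G_meas]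
    by (intro borel_measurable_sum borel_measurable_times) auto
  finally show ?case .
qed

lemma sum_P_meas [measurable]: "(\<lambda>\<omega>. sum_mat (P t n \<omega>)) \<in> borel_measurable M"
  unfolding sum_mat_carrier[OF P_carrier] by (intro borel_measurable_sum P_meas) auto

lemma kron_P_meas:
  assumes "I < d ^ r" "J < d ^ r"
  shows "(\<lambda>\<omega>. kron_pow (P t n \<omega>) r $$ (I, J)) \<in> borel_measurable M"
  using borel_measurable_kron_pow[of "P t n" d d M I r J] P_carrier P_meas assms by blast

lemma kron_P_nonneg:
  assumes "I < d ^ r" "J < d ^ r"
  shows "0 \<le> kron_pow (P t n \<omega>) r $$ (I, J)"
  using mat_nonneg_kron_pow[OF P_nonneg[of t n \<omega>], of r] kron_pow_carrier[OF P_carrier[of t n \<omega>], of r] assms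
  by (auto simp: mat_nonneg_def)

text \<open>
  Independence of the innovations at different times enters only through the next lemma: the expectation
  of a coordinate of the Kronecker power of a random product, weighted by functions of earlier
  innovations, factorises. Peeling off the last factor of the product turns it into one more weight.
\<close>

lemma nn_integral_kron_P:
  fixes g :: "int \<Rightarrow> real \<Rightarrow> ennreal"
  assumes "finite F" "\<And>u. u \<in> F \<Longrightarrow> u \<le> t - int n" "\<And>u. g u \<in> borel_measurable borel"
    and "I < d ^ r" "J < d ^ r"
  shows "(\<integral>\<^sup>+\<omega>. ennreal (kron_pow (P t n \<omega>) r $$ (I, J)) * (\<Prod>u\<in>F. g u (\<epsilon> u \<omega>)) \<partial>M) =
    ennreal (Pmean t n $$ (I, J)) * (\<Prod>u\<in>F. \<integral>\<^sup>+\<omega>. g u (\<epsilon> u \<omega>) \<partial>M)"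
  using assms
proof (induction n arbitrary: F g J)
  case 0
  have [measurable]: "(\<lambda>\<omega>. g u (\<epsilon> u \<omega>)) \<in> borel_measurable M" for u
    using measurable_compose[OF eps_meas 0(3)] .
  show ?case
    using nn_integral_prod_eps[OF 0(1,3)]
    by (simp add: P_0 Pmean_def kron_pow_one nn_integral_cmult)
next
  case (Suc n)
  let ?D = "d ^ r" and ?k = "t - int n"
  define f where "f L x = ennreal (kron_pow (G ?k x) r $$ (L, J))" for L x
  \<comment> \<open>the weights together with the entry \<open>(L, J)\<close> of the last factor; \<open>?k\<close> is a new time\<close>
  define g' where "g' L = g(?k := f L)" for L
  have f_meas: "L < ?D \<Longrightarrow> f L \<in> borel_measurable borel" for L
    unfolding f_def using kron_G_meas[of L J ?k] Suc.prems by simp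
  have g'_meas: "L < ?D \<Longrightarrow> g' L u \<in> borel_measurable borel" for L u
    using f_meas Suc.prems by (simp add: g'_def)
  have [measurable]: "L < ?D \<Longrightarrow> (\<lambda>\<omega>. g' L u (\<epsilon> u \<omega>)) \<in> borel_measurable M" for L u
    using measurable_compose[OF eps_meas g'_meas] .
  have kF: "?k \<notin> F" using Suc.prems(2) by fastforce
  have prod_eq: "(\<Prod>u\<in>insert ?k F. h (g' L u) u) = h (f L) ?k * (\<Prod>u\<in>F. h (g u) u)"
    for L and h :: "(real \<Rightarrow> ennreal) \<Rightarrow> int \<Rightarrow> ennreal"
  proof -
    have "(\<Prod>u\<in>F. h (g' L u) u) = (\<Prod>u\<in>F. h (g u) u)"
      using kF by (intro prod.cong) (auto simp: g'_def)
    then show ?thesis using kF Suc.prems(1) by (simp add: g'_def)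
  qed
  have "(\<integral>\<^sup>+\<omega>. ennreal (kron_pow (P t (Suc n) \<omega>) r $$ (I, J)) * (\<Prod>u\<in>F. g u (\<epsilon> u \<omega>)) \<partial>M) =
      (\<integral>\<^sup>+\<omega>. (\<Sum>L<?D. ennreal (kron_pow (P t n \<omega>) r $$ (I, L)) *
        (\<Prod>u\<in>insert ?k F. g' L u (\<epsilon> u \<omega>))) \<partial>M)"
  proof (intro nn_integral_cong)
    fix \<omega>
    have "kron_pow (P t (Suc n) \<omega>) r $$ (I, J) = (\<Sum>L<?D. kron_pow (P t n \<omega>) r $$ (I, L) *
        kron_pow (G ?k (\<epsilon> ?k \<omega>)) r $$ (L, J))"
      unfolding P_Suc kron_pow_mult[OF P_carrier G_carrier]
      by (rule mult_mat_index[OF kron_pow_carrier[OF P_carrier] kron_pow_carrier[OF G_carrier]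
            Suc.prems(4,5)])
    then have eq: "ennreal (kron_pow (P t (Suc n) \<omega>) r $$ (I, J)) =
        ennreal (\<Sum>L<?D. kron_pow (P t n \<omega>) r $$ (I, L) * kron_pow (G ?k (\<epsilon> ?k \<omega>)) r $$ (L, J))"
      by (rule arg_cong)
    have "ennreal (kron_pow (P t (Suc n) \<omega>) r $$ (I, J)) =
        (\<Sum>L<?D. ennreal (kron_pow (P t n \<omega>) r $$ (I, L)) * f L (\<epsilon> ?k \<omega>))"
      unfolding f_def eq using Suc.prems(4,5)
      by (subst sum_ennreal[symmetric]) (auto simp: ennreal_mult kron_P_nonneg kron_G_nonneg)
    then show "ennreal (kron_pow (P t (Suc n) \<omega>) r $$ (I, J)) * (\<Prod>u\<in>F. g u (\<epsilon> u \<omega>)) =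
        (\<Sum>L<?D. ennreal (kron_pow (P t n \<omega>) r $$ (I, L)) * (\<Prod>u\<in>insert ?k F. g' L u (\<epsilon> u \<omega>)))"
      using prod_eq[of "\<lambda>g u. g (\<epsilon> u \<omega>)"] by (simp add: sum_distrib_right mult.assoc)
  qed
  also have "\<dots> = (\<Sum>L<?D. \<integral>\<^sup>+\<omega>. ennreal (kron_pow (P t n \<omega>) r $$ (I, L)) *
        (\<Prod>u\<in>insert ?k F. g' L u (\<epsilon> u \<omega>)) \<partial>M)"
    using kron_P_meas Suc.prems(4)
    by (intro nn_integral_sum borel_measurable_times_ennreal borel_measurable_prod_ennreal
        measurable_compose[OF _ measurable_ennreal]) auto
  also have "\<dots> = (\<Sum>L<?D. ennreal (Pmean t n $$ (I, L)) *
      (\<Prod>u\<in>insert ?k F. \<integral>\<^sup>+\<omega>. g' L u (\<epsilon> u \<omega>) \<partial>M))"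
    using Suc.prems g'_meas by (intro sum.cong refl Suc.IH) fastforce+
  also have "\<dots> = (\<Sum>L<?D. ennreal (Pmean t n $$ (I, L)) * ennreal (mean ?k $$ (L, J))) *
      (\<Prod>u\<in>F. \<integral>\<^sup>+\<omega>. g u (\<epsilon> u \<omega>) \<partial>M)"
    using prod_eq[of "\<lambda>g u. \<integral>\<^sup>+\<omega>. g (\<epsilon> u \<omega>) \<partial>M"] Suc.prems(5)
    by (simp add: sum_distrib_right mult.assoc mean_entry(1) f_def)
  also have "(\<Sum>L<?D. ennreal (Pmean t n $$ (I, L)) * ennreal (mean ?k $$ (L, J))) =
      ennreal (Pmean t (Suc n) $$ (I, J))"
  proof -
    have "Pmean t (Suc n) = Pmean t n * mean ?k" by (simp add: Pmean_def)
    then have "Pmean t (Suc n) $$ (I, J) = (\<Sum>L<?D. Pmean t n $$ (I, L) * mean ?k $$ (L, J))"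
      using mult_mat_index[OF Pmean_carrier mean_carrier Suc.prems(4,5)] by simp
    moreover have "0 \<le> Pmean t n $$ (I, L)" if "L < ?D" for L
      using Pmean_nonneg[of t n] Pmean_carrier[of t n] Suc.prems(4) that by (auto simp: mat_nonneg_def)
    moreover have "0 \<le> mean ?k $$ (L, J)" if "L < ?D" for L
      using that Suc.prems(5) by (rule mean_entry(2))
    ultimately have eq: "Pmean t (Suc n) $$ (I, J) = (\<Sum>L<?D. Pmean t n $$ (I, L) * mean ?k $$ (L, J))"
      and nn: "\<And>L. L \<in> {..<?D} \<Longrightarrow> 0 \<le> Pmean t n $$ (I, L)" "\<And>L. L \<in> {..<?D} \<Longrightarrow> 0 \<le> mean ?k $$ (L, J)"
      by auto
    have "(\<Sum>L<?D. ennreal (Pmean t n $$ (I, L)) * ennreal (mean ?k $$ (L, J))) =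
        (\<Sum>L<?D. ennreal (Pmean t n $$ (I, L) * mean ?k $$ (L, J)))"
      using nn by (intro sum.cong refl ennreal_mult[symmetric])
    also have "\<dots> = ennreal (\<Sum>L<?D. Pmean t n $$ (I, L) * mean ?k $$ (L, J))"
      using nn by (intro sum_ennreal mult_nonneg_nonneg)
    finally show ?thesis unfolding eq .
  qed
  finally show ?case .
qed

text \<open>
  Summed over all coordinates: \<open>sum_mat\<close> is multiplicative on Kronecker products, so the moment
  of order \<open>r\<close> of the size of the random product is the size of the product of the means.
\<close>

lemma nn_integral_sum_P:
  fixes g :: "int \<Rightarrow> real \<Rightarrow> ennreal"
  assumes F: "finite F" "\<And>u. u \<in> F \<Longrightarrow> u \<le> t - int n" and g: "\<And>u. g u \<in> borel_measurable borel"
  shows "(\<integral>\<^sup>+\<omega>. ennreal (sum_mat (P t n \<omega>) ^ r) * (\<Prod>u\<in>F. g u (\<epsilon> u \<omega>)) \<partial>M) =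
    ennreal (sum_mat (Pmean t n)) * (\<Prod>u\<in>F. \<integral>\<^sup>+\<omega>. g u (\<epsilon> u \<omega>) \<partial>M)"
proof -
  let ?D = "d ^ r"
  have [measurable]: "(\<lambda>\<omega>. g u (\<epsilon> u \<omega>)) \<in> borel_measurable M" for u
    using measurable_compose[OF eps_meas g] .
  have "(\<integral>\<^sup>+\<omega>. ennreal (sum_mat (P t n \<omega>) ^ r) * (\<Prod>u\<in>F. g u (\<epsilon> u \<omega>)) \<partial>M) =
    (\<integral>\<^sup>+\<omega>. (\<Sum>I<?D. \<Sum>J<?D. ennreal (kron_pow (P t n \<omega>) r $$ (I, J)) *
      (\<Prod>u\<in>F. g u (\<epsilon> u \<omega>))) \<partial>M)"
  proof (intro nn_integral_cong)
    fix \<omega>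
    have "sum_mat (P t n \<omega>) ^ r = (\<Sum>I<?D. \<Sum>J<?D. kron_pow (P t n \<omega>) r $$ (I, J))"
      using sum_mat_carrier[OF kron_pow_carrier[OF P_carrier]] by (simp add: sum_mat_kron_pow)
    then have eq: "ennreal (sum_mat (P t n \<omega>) ^ r) =
        ennreal (\<Sum>I<?D. \<Sum>J<?D. kron_pow (P t n \<omega>) r $$ (I, J))"
      by (rule arg_cong)
    have "ennreal (sum_mat (P t n \<omega>) ^ r) =
        (\<Sum>I<?D. \<Sum>J<?D. ennreal (kron_pow (P t n \<omega>) r $$ (I, J)))"
      unfolding eq
      by (rule ennreal_sum_sum) (rule kron_P_nonneg)
    then show "ennreal (sum_mat (P t n \<omega>) ^ r) * (\<Prod>u\<in>F. g u (\<epsilon> u \<omega>)) =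
        (\<Sum>I<?D. \<Sum>J<?D. ennreal (kron_pow (P t n \<omega>) r $$ (I, J)) * (\<Prod>u\<in>F. g u (\<epsilon> u \<omega>)))"
      by (simp add: sum_distrib_right)
  qed
  also have "\<dots> = (\<Sum>I<?D. \<Sum>J<?D. \<integral>\<^sup>+\<omega>. ennreal (kron_pow (P t n \<omega>) r $$ (I, J)) *
      (\<Prod>u\<in>F. g u (\<epsilon> u \<omega>)) \<partial>M)"
  proof -
    have m: "(\<lambda>\<omega>. ennreal (kron_pow (P t n \<omega>) r $$ (I, J)) * (\<Prod>u\<in>F. g u (\<epsilon> u \<omega>))) \<in> borel_measurable M"
      if "I < ?D" "J < ?D" for I J
      using kron_P_meas[OF that]
      by (intro borel_measurable_times_ennreal borel_measurable_prod_ennreal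
          measurable_compose[OF _ measurable_ennreal]) auto
    show ?thesis
      by (subst nn_integral_sum) (auto intro!: borel_measurable_sum m sum.cong nn_integral_sum)
  qed
  also have "\<dots> = (\<Sum>I<?D. \<Sum>J<?D. ennreal (Pmean t n $$ (I, J))) *
      (\<Prod>u\<in>F. \<integral>\<^sup>+\<omega>. g u (\<epsilon> u \<omega>) \<partial>M)"
    using nn_integral_kron_P[OF F g] by (simp add: sum_distrib_right)
  also have "(\<Sum>I<?D. \<Sum>J<?D. ennreal (Pmean t n $$ (I, J))) = ennreal (sum_mat (Pmean t n))"
  proof -
    have "0 \<le> Pmean t n $$ (I, J)" if "I < ?D" "J < ?D" for I J
      using Pmean_nonneg[of t n] Pmean_carrier[of t n] that by (auto simp: mat_nonneg_def)
    then show ?thesis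
      unfolding sum_mat_carrier[OF Pmean_carrier] by (intro ennreal_sum_sum[symmetric])
  qed
  finally show ?thesis .
qed

section \<open>Finite moments from a spectral radius below one\<close>

lemma c_nonneg: "0 \<le> c"
proof -
  have "0 \<le> vec_sum (B 0 0)" by (rule vec_sum_nonneg[OF B_nonneg])
  also have "\<dots> \<le> c" using B_growth[of 0 0] by simp
  finally show ?thesis .
qed

lemma sum_Pmean_nonneg: "0 \<le> sum_mat (Pmean t n)"
  by (rule sum_mat_nonneg[OF Pmean_nonneg])

lemma sum_Pmean_add_le: "sum_mat (Pmean t (m + n)) \<le> sum_mat (Pmean t m) * sum_mat (Pmean (t - int m) n)"
  unfolding Pmean_add by (rule sum_mat_mult_le[OF Pmean_carrier Pmean_nonneg Pmean_carrier Pmean_nonneg])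

text \<open>
  Products of \<open>n\<close> mean matrices decay geometrically in \<open>n\<close>, whatever the time of the first factor:
  up to incomplete periods at both ends they are powers of the mean matrix of one period.
\<close>

lemma summable_Pmean:
  assumes rho: "real_spectral_radius (Pmean (int s) s) < 1"
  shows "\<exists>\<kappa>>1. \<forall>t. summable (\<lambda>n. sum_mat (Pmean t n) * \<kappa> ^ n)"
proof -
  have D: "d ^ r > 0" using d_pos by simp
  obtain C l where l: "0 < l" "l < 1" and C: "\<And>k. sum_mat (Pmean (int s) s ^\<^sub>m k) \<le> C * l ^ k"
    using spectral_radius_less_1_decay[OF Pmean_carrier D rho] by blast
  have "0 \<le> sum_mat (Pmean (int s) (s * 0))" by (rule sum_Pmean_nonneg)
  also have "\<dots> \<le> C * l ^ 0" unfolding Pmean_pow by (rule C)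
  finally have C0: "0 \<le> C" by simp
  define \<mu> where "\<mu> = root s l"
  have \<mu>: "0 < \<mu>" "\<mu> < 1" "\<mu> ^ s = l" using l s_pos by (auto simp: \<mu>_def)
  \<comment> \<open>any number strictly between \<open>1\<close> and \<open>1 / \<mu>\<close>\<close>
  define \<kappa> where "\<kappa> = (1 + 1 / \<mu>) / 2"
  have \<kappa>: "\<kappa> > 1" using \<mu> by (simp add: \<kappa>_def field_simps)
  have "\<kappa> * \<mu> = (\<mu> + 1) / 2" using \<mu> by (simp add: \<kappa>_def field_simps)
  then have \<kappa>\<mu>: "0 < \<kappa> * \<mu>" "\<kappa> * \<mu> < 1" using \<mu> by auto
  define W where "W = (\<Sum>w<s. sum_mat (Pmean (int s) w))"
  have W0: "0 \<le> W" unfolding W_def by (intro sum_nonneg sum_Pmean_nonneg)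
  have base: "sum_mat (Pmean (int s) n) \<le> (C * W / l) * \<mu> ^ n" for n
  proof -
    define i w where "i = n div s" and "w = n mod s"
    have n: "n = s * i + w" and w: "w < s" using s_pos by (auto simp: i_def w_def)
    have "Pmean (int s - int (s * i)) w = Pmean (int s) w"
      using Pmean_periodic_mult[of "int s" "- int i" w] by simp
    then have "sum_mat (Pmean (int s) n) \<le> sum_mat (Pmean (int s) (s * i)) * sum_mat (Pmean (int s) w)"
      using sum_Pmean_add_le[of "int s" "s * i" w] by (simp add: n)
    also have "\<dots> \<le> (C * l ^ i) * W"
    proof (intro mult_mono)
      show "sum_mat (Pmean (int s) (s * i)) \<le> C * l ^ i" using C[of i] by (simp add: Pmean_pow)
      show "sum_mat (Pmean (int s) w) \<le> W" unfolding W_def using w sum_Pmean_nonneg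
        by (intro member_le_sum) auto
    qed (use C0 l sum_Pmean_nonneg in auto)
    also have "\<dots> = C * W * l ^ i" by simp
    also have "\<dots> \<le> C * W * (\<mu> ^ n / l)"
    proof (intro mult_left_mono)
      have "l ^ i * l = \<mu> ^ (s * i) * \<mu> ^ s" by (simp add: \<mu>(3) power_mult)
      also have "\<dots> \<le> \<mu> ^ (s * i) * \<mu> ^ w"
        using \<mu> w by (intro mult_left_mono power_decreasing) auto
      also have "\<dots> = \<mu> ^ n" by (simp add: n power_add)
      finally show "l ^ i \<le> \<mu> ^ n / l" using l by (simp add: field_simps)
    qed (use C0 W0 in auto)
    finally show ?thesis by simp
  qed
  have sum_base: "summable (\<lambda>n. sum_mat (Pmean (int s) n) * \<kappa> ^ n)"
  proof (rule summable_comparison_test')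
    show "summable (\<lambda>n. C * W / l * (\<kappa> * \<mu>) ^ n)"
      using \<kappa>\<mu> by (intro summable_mult summable_geometric) auto
    fix n :: nat
    have "norm (sum_mat (Pmean (int s) n) * \<kappa> ^ n) = sum_mat (Pmean (int s) n) * \<kappa> ^ n"
      using sum_Pmean_nonneg \<kappa> by simp
    also have "\<dots> \<le> (C * W / l) * \<mu> ^ n * \<kappa> ^ n" using base[of n] \<kappa> by (intro mult_right_mono) auto
    finally show "norm (sum_mat (Pmean (int s) n) * \<kappa> ^ n) \<le> C * W / l * (\<kappa> * \<mu>) ^ n"
      by (simp add: power_mult_distrib mult_ac)
  qed
  have "summable (\<lambda>n. sum_mat (Pmean t n) * \<kappa> ^ n)" for t
  proof -
    \<comment> \<open>after the first \<open>v\<close> factors the product starts at a multiple of \<open>s\<close>\<close>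
    define v where "v = nat (t mod int s)"
    have v: "t - int v = int s + int s * (t div int s - 1)"
      using s_pos by (simp add: v_def algebra_simps minus_mod_eq_mult_div)
    have "summable (\<lambda>n. sum_mat (Pmean t (n + v)) * \<kappa> ^ (n + v))"
    proof (rule summable_comparison_test')
      show "summable (\<lambda>n. (sum_mat (Pmean t v) * \<kappa> ^ v) * (sum_mat (Pmean (int s) n) * \<kappa> ^ n))"
        by (intro summable_mult sum_base)
      fix n :: nat
      have "sum_mat (Pmean t (v + n)) \<le> sum_mat (Pmean t v) * sum_mat (Pmean (int s) n)"
        using sum_Pmean_add_le[of t v n] unfolding v Pmean_periodic_mult .
      then have "sum_mat (Pmean t (n + v)) * \<kappa> ^ (n + v) \<le>
          (sum_mat (Pmean t v) * sum_mat (Pmean (int s) n)) * \<kappa> ^ (n + v)"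
        using \<kappa> by (intro mult_right_mono) (auto simp: add.commute)
      then show "norm (sum_mat (Pmean t (n + v)) * \<kappa> ^ (n + v)) \<le>
          (sum_mat (Pmean t v) * \<kappa> ^ v) * (sum_mat (Pmean (int s) n) * \<kappa> ^ n)"
        using sum_Pmean_nonneg \<kappa> by (simp add: power_add mult_ac)
    qed
    then show ?thesis by (rule summable_iff_shift[THEN iffD1])
  qed
  then show ?thesis using \<kappa> by blast
qed

lemma vec_sum_iterate:
  assumes carrier: "\<And>t. u t \<in> carrier_vec d"
    and nonneg: "\<And>t. vec_nonneg (u t)"
    and step: "\<And>t. u t = G t (\<epsilon> t \<omega>) *\<^sub>v u (t - 1) + B t (\<epsilon> t \<omega>)"
  shows "vec_sum (u t) \<le> (\<Sum>k<n. sum_mat (P t k \<omega>) * vec_sum (B (t - int k) (\<epsilon> (t - int k) \<omega>))) +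
    sum_mat (P t n \<omega>) * vec_sum (u (t - int n))"
proof -
  have "vec_sum (u t) \<le> (\<Sum>k<n. sum_mat (P t k \<omega>) * vec_sum (B (t - int k) (\<epsilon> (t - int k) \<omega>))) +
    vec_sum (P t n \<omega> *\<^sub>v u (t - int n))"
  proof (induction n)
    case 0
    then show ?case using carrier[of t] by (simp add: P_0)
  next
    case (Suc n)
    let ?k = "t - int n"
    have eq: "t - int (Suc n) = ?k - 1" by simp
    have "P t n \<omega> *\<^sub>v u ?k = P t n \<omega> *\<^sub>v (G ?k (\<epsilon> ?k \<omega>) *\<^sub>v u (?k - 1)) + P t n \<omega> *\<^sub>v B ?k (\<epsilon> ?k \<omega>)"
      by (subst step, rule mult_add_distrib_mat_vec[OF P_carrier
            mult_mat_vec_carrier[OF G_carrier carrier] B_carrier])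
    also have "P t n \<omega> *\<^sub>v (G ?k (\<epsilon> ?k \<omega>) *\<^sub>v u (?k - 1)) = P t (Suc n) \<omega> *\<^sub>v u (?k - 1)"
      unfolding P_Suc by (rule assoc_mult_mat_vec[symmetric, OF P_carrier G_carrier carrier])
    finally have "vec_sum (P t n \<omega> *\<^sub>v u ?k) = vec_sum (P t (Suc n) \<omega> *\<^sub>v u (?k - 1)) +
        vec_sum (P t n \<omega> *\<^sub>v B ?k (\<epsilon> ?k \<omega>))"
      using vec_sum_add[OF mult_mat_vec_carrier[OF P_carrier carrier] mult_mat_vec_carrier[OF P_carrier B_carrier]]
      by simp
    also have "\<dots> \<le> vec_sum (P t (Suc n) \<omega> *\<^sub>v u (?k - 1)) + sum_mat (P t n \<omega>) * vec_sum (B ?k (\<epsilon> ?k \<omega>))"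
      by (intro add_left_mono vec_sum_mult_le[OF P_carrier P_nonneg B_carrier B_nonneg])
    finally show ?case using Suc unfolding eq by simp
  qed
  also have "vec_sum (P t n \<omega> *\<^sub>v u (t - int n)) \<le> sum_mat (P t n \<omega>) * vec_sum (u (t - int n))"
    by (rule vec_sum_mult_le[OF P_carrier P_nonneg carrier nonneg])
  finally show ?thesis by simp
qed

lemma sum_B_meas: "(\<lambda>x. vec_sum (B t x)) \<in> borel_measurable borel"
  unfolding vec_sum_carrier[OF B_carrier] by (intro borel_measurable_sum B_meas) auto

lemma sum_B_eps_meas [measurable]: "(\<lambda>\<omega>. vec_sum (B t (\<epsilon> t' \<omega>))) \<in> borel_measurable M"
  by (rule measurable_compose[OF eps_meas sum_B_meas])

lemma nn_integral_P_B:
  "(\<integral>\<^sup>+\<omega>. ennreal ((sum_mat (P t k \<omega>) * vec_sum (B (t - int k) (\<epsilon> (t - int k) \<omega>))) ^ r) \<partial>M) \<le>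
    ennreal (sum_mat (Pmean t k)) * (ennreal (c ^ r) * (\<integral>\<^sup>+\<omega>. ennreal ((1 + (\<epsilon> 0 \<omega>)\<^sup>2) ^ r) \<partial>M))"
proof -
  let ?k = "t - int k"
  define g where "g = (\<lambda>(u::int) x. ennreal (vec_sum (B ?k x) ^ r))"
  have g: "g u \<in> borel_measurable borel" for u unfolding g_def using sum_B_meas[of ?k] by simp
  have "(\<integral>\<^sup>+\<omega>. ennreal ((sum_mat (P t k \<omega>) * vec_sum (B ?k (\<epsilon> ?k \<omega>))) ^ r) \<partial>M) =
      (\<integral>\<^sup>+\<omega>. ennreal (sum_mat (P t k \<omega>) ^ r) * (\<Prod>u\<in>{?k}. g u (\<epsilon> u \<omega>)) \<partial>M)"
    using sum_mat_nonneg[OF P_nonneg] vec_sum_nonneg[OF B_nonneg]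
    by (simp add: g_def power_mult_distrib ennreal_mult)
  also have "\<dots> = ennreal (sum_mat (Pmean t k)) * (\<integral>\<^sup>+\<omega>. g ?k (\<epsilon> ?k \<omega>) \<partial>M)"
    by (subst nn_integral_sum_P) (auto simp: g)
  also have "(\<integral>\<^sup>+\<omega>. g ?k (\<epsilon> ?k \<omega>) \<partial>M) = (\<integral>\<^sup>+\<omega>. g ?k (\<epsilon> 0 \<omega>) \<partial>M)" by (rule nn_integral_eps[OF g])
  also have "\<dots> \<le> (\<integral>\<^sup>+\<omega>. ennreal (c ^ r) * ennreal ((1 + (\<epsilon> 0 \<omega>)\<^sup>2) ^ r) \<partial>M)"
  proof (intro nn_integral_mono)
    fix \<omega>
    have "vec_sum (B ?k (\<epsilon> 0 \<omega>)) ^ r \<le> (c * (1 + (\<epsilon> 0 \<omega>)\<^sup>2)) ^ r"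
      by (intro power_mono B_growth vec_sum_nonneg B_nonneg)
    then show "g ?k (\<epsilon> 0 \<omega>) \<le> ennreal (c ^ r) * ennreal ((1 + (\<epsilon> 0 \<omega>)\<^sup>2) ^ r)"
      using c_nonneg by (simp add: g_def power_mult_distrib ennreal_leI flip: ennreal_mult)
  qed
  also have "\<dots> = ennreal (c ^ r) * (\<integral>\<^sup>+\<omega>. ennreal ((1 + (\<epsilon> 0 \<omega>)\<^sup>2) ^ r) \<partial>M)"
    by (rule nn_integral_cmult) simp
  finally show ?thesis by (simp add: mult_left_mono)
qed

text \<open>
  The first half, for an arbitrary solution whose size has the same law at the times \<open>t - s * j\<close>
  as at time \<open>t\<close>; it need not be a function of the past innovations. Iterating the recursion \<open>n\<close>
  times leaves a remainder of size at most \<open>sum_mat (P t n) * vec_sum (u (t - n))\<close>. Here the first factor tends to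
  zero in probability and the second one is tight, so along whole periods this
  product is at most one with probability tending to one. Hence almost surely it is at most
  one for some \<open>n\<close>, and there the solution is controlled by the integrable majorant \<open>F\<close>.
\<close>

theorem nn_integral_power_finite:
  assumes rho: "real_spectral_radius (Pmean (int s) s) < 1"
    and carrier: "\<And>t \<omega>. \<omega> \<in> space M \<Longrightarrow> u t \<omega> \<in> carrier_vec d"
    and meas: "\<And>t. (\<lambda>\<omega>. vec_sum (u t \<omega>)) \<in> borel_measurable M"
    and sol: "AE \<omega> in M. \<forall>t. vec_nonneg (u t \<omega>) \<and>
      u t \<omega> = G t (\<epsilon> t \<omega>) *\<^sub>v u (t - 1) \<omega> + B t (\<epsilon> t \<omega>)"
    and law: "\<And>j. distr M borel (\<lambda>\<omega>. vec_sum (u (t - int (s * j)) \<omega>)) =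
      distr M borel (\<lambda>\<omega>. vec_sum (u t \<omega>))"
  shows "(\<integral>\<^sup>+\<omega>. ennreal (vec_sum (u t \<omega>) ^ r) \<partial>M) < \<infinity>"
proof -
  note meas [measurable]
  obtain \<kappa> where \<kappa>: "\<kappa> > 1" and summ: "summable (\<lambda>n. sum_mat (Pmean t n) * \<kappa> ^ n)"
    using summable_Pmean[OF rho] by blast
  \<comment> \<open>the ratio for which the weights \<open>q\<^sup>-\<^sup>k\<^sup>r\<close> of \<open>sum_power_le_geometric\<close> are \<open>\<kappa>\<^sup>k\<close>\<close>
  define q where "q = root r (1 / \<kappa>)"
  have q: "0 < q" "q < 1" "q ^ r = 1 / \<kappa>" using \<kappa> r_pos by (auto simp: q_def)
  define x where "x k \<omega> = sum_mat (P t k \<omega>) * vec_sum (B (t - int k) (\<epsilon> (t - int k) \<omega>))" for k \<omega>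
  have x0: "0 \<le> x k \<omega>" for k \<omega>
    unfolding x_def by (intro mult_nonneg_nonneg sum_mat_nonneg P_nonneg vec_sum_nonneg B_nonneg)
  have [measurable]: "x k \<in> borel_measurable M" for k unfolding x_def by measurable
  have xq: "(x k \<omega> / q ^ k) ^ r = x k \<omega> ^ r * \<kappa> ^ k" for k \<omega>
  proof -
    have "(q ^ k) ^ r = (q ^ r) ^ k" by (simp flip: power_mult add: mult.commute)
    then show ?thesis using q \<kappa> by (simp add: power_divide)
  qed
  define S where "S \<omega> = (\<Sum>k. ennreal (x k \<omega> ^ r * \<kappa> ^ k))" for \<omega>
  have [measurable]: "S \<in> borel_measurable M" unfolding S_def by measurable
  define b where "b = ennreal (c ^ r) * (\<integral>\<^sup>+\<omega>. ennreal ((1 + (\<epsilon> 0 \<omega>)\<^sup>2) ^ r) \<partial>M)"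
  have b: "b < \<infinity>" using nn_integral_moment[of 0] by (simp add: b_def ennreal_mult_less_top)
  have S_fin: "(\<integral>\<^sup>+\<omega>. S \<omega> \<partial>M) < \<infinity>"
  proof -
    have "(\<integral>\<^sup>+\<omega>. S \<omega> \<partial>M) = (\<Sum>k. \<integral>\<^sup>+\<omega>. ennreal (x k \<omega> ^ r * \<kappa> ^ k) \<partial>M)"
      unfolding S_def by (intro nn_integral_suminf) measurable
    also have "\<dots> \<le> (\<Sum>k. ennreal (sum_mat (Pmean t k) * \<kappa> ^ k) * b)"
    proof (intro suminf_le summableI)
      fix k
      have "(\<integral>\<^sup>+\<omega>. ennreal (x k \<omega> ^ r * \<kappa> ^ k) \<partial>M) = (\<integral>\<^sup>+\<omega>. ennreal (x k \<omega> ^ r) \<partial>M) * ennreal (\<kappa> ^ k)"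
        using x0 \<kappa> by (simp add: ennreal_mult nn_integral_multc)
      also have "\<dots> \<le> (ennreal (sum_mat (Pmean t k)) * b) * ennreal (\<kappa> ^ k)"
        using nn_integral_P_B[of t k] unfolding x_def b_def by (intro mult_right_mono) auto
      also have "\<dots> = ennreal (sum_mat (Pmean t k) * \<kappa> ^ k) * b"
        using sum_Pmean_nonneg \<kappa> by (simp add: ennreal_mult mult_ac)
      finally show "(\<integral>\<^sup>+\<omega>. ennreal (x k \<omega> ^ r * \<kappa> ^ k) \<partial>M) \<le> ennreal (sum_mat (Pmean t k) * \<kappa> ^ k) * b" .
    qed
    also have "\<dots> = ennreal (\<Sum>k. sum_mat (Pmean t k) * \<kappa> ^ k) * b"
      using summ sum_Pmean_nonneg \<kappa> by (simp add: ennreal_suminf_multc suminf_ennreal2)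
    also have "\<dots> < \<infinity>" using b by (simp add: ennreal_mult_less_top)
    finally show ?thesis .
  qed
  define c1 where "c1 = (1 / (1 - q)) ^ r"
  have c1: "0 \<le> c1" using q by (simp add: c1_def)
  define F where "F \<omega> = ennreal (2 ^ r) * (ennreal c1 * S \<omega> + 1)" for \<omega>
  have [measurable]: "F \<in> borel_measurable M" unfolding F_def by measurable
  define bad where "bad = {\<omega> \<in> space M. \<not> ennreal (vec_sum (u t \<omega>) ^ r) \<le> F \<omega>}"
  have [measurable]: "bad \<in> sets M" unfolding bad_def by measurable
  have good: "AE \<omega> in M. \<forall>n. sum_mat (P t n \<omega>) * vec_sum (u (t - int n) \<omega>) \<le> 1 \<longrightarrow>
      ennreal (vec_sum (u t \<omega>) ^ r) \<le> F \<omega>"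
    using sol AE_space
  proof eventually_elim
    case (elim \<omega>)
    have car: "\<And>t. u t \<omega> \<in> carrier_vec d" and nn_u: "\<And>t. vec_nonneg (u t \<omega>)"
      and rec: "\<And>t. u t \<omega> = G t (\<epsilon> t \<omega>) *\<^sub>v u (t - 1) \<omega> + B t (\<epsilon> t \<omega>)"
      using elim carrier by blast+
    show ?case
    proof (intro allI impI)
      fix n assume n: "sum_mat (P t n \<omega>) * vec_sum (u (t - int n) \<omega>) \<le> 1"
      have "vec_sum (u t \<omega>) \<le> (\<Sum>k<n. x k \<omega>) + sum_mat (P t n \<omega>) * vec_sum (u (t - int n) \<omega>)"
        unfolding x_def by (rule vec_sum_iterate[of "\<lambda>t. u t \<omega>", OF car nn_u rec])
      then have "vec_sum (u t \<omega>) ^ r \<le> ((\<Sum>k<n. x k \<omega>) + 1) ^ r"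
        using n by (intro power_mono vec_sum_nonneg nn_u) linarith
      also have "\<dots> \<le> 2 ^ r * ((\<Sum>k<n. x k \<omega>) ^ r + 1 ^ r)"
        using x0 by (intro power_add_le sum_nonneg) auto
      also have "\<dots> \<le> 2 ^ r * (c1 * (\<Sum>k<n. x k \<omega> ^ r * \<kappa> ^ k) + 1)"
        using sum_power_le_geometric[of "\<lambda>k. x k \<omega>" q r n, OF x0 q(1,2) r_pos] by (simp add: xq c1_def)
      finally have "ennreal (vec_sum (u t \<omega>) ^ r) \<le> ennreal (2 ^ r * (c1 * (\<Sum>k<n. x k \<omega> ^ r * \<kappa> ^ k) + 1))"
        by (rule ennreal_leI)
      also have "\<dots> = ennreal (2 ^ r) * (ennreal c1 * (\<Sum>k<n. ennreal (x k \<omega> ^ r * \<kappa> ^ k)) + 1)"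
      proof -
        have nn: "0 \<le> x k \<omega> ^ r * \<kappa> ^ k" for k using x0 \<kappa> by simp
        define T where "T = (\<Sum>k<n. x k \<omega> ^ r * \<kappa> ^ k)"
        have T0: "0 \<le> T" unfolding T_def by (intro sum_nonneg nn)
        have T: "(\<Sum>k<n. ennreal (x k \<omega> ^ r * \<kappa> ^ k)) = ennreal T"
          unfolding T_def by (rule sum_ennreal) (rule nn)
        have "ennreal (c1 * T + 1) = ennreal c1 * ennreal T + 1"
          using c1 T0 ennreal_plus[of "c1 * T" 1] by (simp add: ennreal_mult)
        then have "ennreal (2 ^ r * (c1 * T + 1)) = ennreal (2 ^ r) * (ennreal c1 * ennreal T + 1)"
          using c1 T0 ennreal_mult[of "2 ^ r" "c1 * T + 1"] by simp
        then show ?thesis unfolding T by (simp only: T_def)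
      qed
      also have "\<dots> \<le> F \<omega>"
        unfolding F_def S_def by (intro mult_left_mono add_right_mono sum_le_suminf) auto
      finally show "ennreal (vec_sum (u t \<omega>) ^ r) \<le> F \<omega>" .
    qed
  qed
  have bad_le: "measure M bad \<le> measure M {\<omega> \<in> space M. vec_sum (u t \<omega>) > real L}" if L: "L > 0" for L :: nat
  proof -
    \<comment> \<open>on \<open>bad\<close> the remainder after \<open>s * j\<close> steps exceeds one, so one of its factors is large\<close>
    have step: "measure M bad \<le> measure M {\<omega> \<in> space M. vec_sum (u t \<omega>) > real L} +
        real L ^ r * sum_mat (Pmean t (s * j))" for j
    proof -
      let ?V = "{\<omega> \<in> space M. vec_sum (u (t - int (s * j)) \<omega>) > real L}"
      let ?X = "{\<omega> \<in> space M. sum_mat (P t (s * j) \<omega>) > 1 / real L}"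
      have "measure M bad \<le> measure M (?V \<union> ?X)"
      proof (rule finite_measure_mono_AE)
        show "AE \<omega> in M. \<omega> \<in> bad \<longrightarrow> \<omega> \<in> ?V \<union> ?X"
          using good sol AE_space
        proof eventually_elim
          case (elim \<omega>)
          have nn_u: "\<And>t. vec_nonneg (u t \<omega>)"
            and gd: "\<And>n. sum_mat (P t n \<omega>) * vec_sum (u (t - int n) \<omega>) \<le> 1 \<Longrightarrow>
              ennreal (vec_sum (u t \<omega>) ^ r) \<le> F \<omega>"
            using elim by blast+
          show ?case
          proof (rule impI, rule ccontr)
            assume *: "\<omega> \<in> bad" "\<omega> \<notin> ?V \<union> ?X"
            then have "sum_mat (P t (s * j) \<omega>) * vec_sum (u (t - int (s * j)) \<omega>) \<le> (1 / real L) * real L"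
              using elim(3) by (intro mult_mono vec_sum_nonneg nn_u) auto
            then have "sum_mat (P t (s * j) \<omega>) * vec_sum (u (t - int (s * j)) \<omega>) \<le> 1" using L by simp
            then have "ennreal (vec_sum (u t \<omega>) ^ r) \<le> F \<omega>" by (rule gd)
            then show False using * by (simp add: bad_def)
          qed
        qed
      qed measurable
      also have "\<dots> \<le> measure M ?V + measure M ?X"
        by (rule measure_Un_le) measurable
      also have "measure M ?V = measure M {\<omega> \<in> space M. vec_sum (u t \<omega>) > real L}"
      proof -
        have "measure M {\<omega> \<in> space M. vec_sum (u t' \<omega>) > real L} =
            measure (distr M borel (\<lambda>\<omega>. vec_sum (u t' \<omega>))) {real L<..}" for t'
          by (subst measure_distr) (auto intro!: arg_cong[of _ _ "measure M"])
        then show ?thesis using law[of j] by simp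
      qed
      also have "measure M ?X \<le> real L ^ r * sum_mat (Pmean t (s * j))"
      proof -
        have "emeasure M ?X = (\<integral>\<^sup>+\<omega>. indicator ?X \<omega> \<partial>M)" by (subst nn_integral_indicator) measurable
        \<comment> \<open>Markov's inequality for the \<open>r\<close>-th power\<close>
        also have "\<dots> \<le> (\<integral>\<^sup>+\<omega>. ennreal (real L ^ r) * ennreal (sum_mat (P t (s * j) \<omega>) ^ r) \<partial>M)"
        proof (intro nn_integral_mono)
          fix \<omega>
          show "indicator ?X \<omega> \<le> ennreal (real L ^ r) * ennreal (sum_mat (P t (s * j) \<omega>) ^ r)"
          proof (cases "\<omega> \<in> ?X")
            case True
            then have "1 \<le> real L * sum_mat (P t (s * j) \<omega>)" using L by (simp add: field_simps)
            then have "1 \<le> (real L * sum_mat (P t (s * j) \<omega>)) ^ r" by (rule one_le_power)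
            then have "ennreal 1 \<le> ennreal (real L ^ r * sum_mat (P t (s * j) \<omega>) ^ r)"
              by (intro ennreal_leI) (simp add: power_mult_distrib)
            then show ?thesis using True by (simp add: ennreal_mult')
          qed simp
        qed
        also have "\<dots> = ennreal (real L ^ r) * ennreal (sum_mat (Pmean t (s * j)))"
          using nn_integral_sum_P[of "{}" t "s * j" "\<lambda>_ _. 1"] by (simp add: nn_integral_cmult)
        also have "\<dots> = ennreal (real L ^ r * sum_mat (Pmean t (s * j)))" by (simp add: ennreal_mult')
        finally show ?thesis
          using sum_Pmean_nonneg by (simp add: emeasure_eq_measure)
      qed
      finally show ?thesis by simp
    qed
    have "(\<lambda>n. sum_mat (Pmean t n)) \<longlonglongrightarrow> 0"
    proof (rule tendsto_sandwich[OF _ _ tendsto_const summable_LIMSEQ_zero[OF summ]])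
      show "\<forall>\<^sub>F n in sequentially. sum_mat (Pmean t n) \<le> sum_mat (Pmean t n) * \<kappa> ^ n"
      proof (rule always_eventually, rule allI)
        fix n
        have "1 \<le> \<kappa> ^ n" using \<kappa> by (intro one_le_power) simp
        from mult_left_mono[OF this sum_Pmean_nonneg[of t n]]
        show "sum_mat (Pmean t n) \<le> sum_mat (Pmean t n) * \<kappa> ^ n" by simp
      qed
      show "\<forall>\<^sub>F n in sequentially. 0 \<le> sum_mat (Pmean t n)"
        by (rule always_eventually) (simp add: sum_Pmean_nonneg)
    qed
    then have "(\<lambda>j. sum_mat (Pmean t (s * j))) \<longlonglongrightarrow> 0"
      using filterlim_compose[of "\<lambda>n. sum_mat (Pmean t n)" "nhds 0" sequentially "\<lambda>j. s * j" sequentially]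
        mult_nat_left_at_top[of s] s_pos by auto
    then have "(\<lambda>j. measure M {\<omega> \<in> space M. vec_sum (u t \<omega>) > real L} +
        real L ^ r * sum_mat (Pmean t (s * j))) \<longlonglongrightarrow>
        measure M {\<omega> \<in> space M. vec_sum (u t \<omega>) > real L} + real L ^ r * 0"
      by (intro tendsto_intros)
    then have "measure M bad \<le> measure M {\<omega> \<in> space M. vec_sum (u t \<omega>) > real L} + real L ^ r * 0"
      by (rule LIMSEQ_le_const) (use step in auto)
    then show ?thesis by simp
  qed
  have "(\<lambda>L. measure M {\<omega> \<in> space M. vec_sum (u t \<omega>) > real L}) \<longlonglongrightarrow>
      measure M (\<Inter>L. {\<omega> \<in> space M. vec_sum (u t \<omega>) > real L})"
    by (rule finite_Lim_measure_decseq) (auto simp: decseq_def)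
  also have "(\<Inter>L. {\<omega> \<in> space M. vec_sum (u t \<omega>) > real L}) = {}"
  proof (intro equals0I)
    fix \<omega> assume "\<omega> \<in> (\<Inter>L. {\<omega> \<in> space M. vec_sum (u t \<omega>) > real L})"
    moreover obtain L where "vec_sum (u t \<omega>) < real L" using reals_Archimedean2 by blast
    ultimately show False by (auto dest: spec[of _ L])
  qed
  finally have "(\<lambda>L. measure M {\<omega> \<in> space M. vec_sum (u t \<omega>) > real L}) \<longlonglongrightarrow> 0" by simp
  then have "measure M bad \<le> 0"
  proof (rule LIMSEQ_le_const, intro exI[of _ "1::nat"] allI impI)
    fix L :: nat assume "1 \<le> L"
    then show "measure M bad \<le> measure M {\<omega> \<in> space M. vec_sum (u t \<omega>) > real L}"
      by (intro bad_le) simp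
  qed
  then have "measure M bad = 0" using measure_nonneg[of M bad] by linarith
  then have "bad \<in> null_sets M" by (auto simp: null_sets_def emeasure_eq_measure)
  then have "AE \<omega> in M. \<omega> \<notin> bad" by (rule AE_not_in)
  then have "AE \<omega> in M. ennreal (vec_sum (u t \<omega>) ^ r) \<le> F \<omega>"
    using AE_space by eventually_elim (auto simp: bad_def)
  then have "(\<integral>\<^sup>+\<omega>. ennreal (vec_sum (u t \<omega>) ^ r) \<partial>M) \<le> (\<integral>\<^sup>+\<omega>. F \<omega> \<partial>M)"
    by (rule nn_integral_mono_AE)
  also have "\<dots> = ennreal (2 ^ r) * (ennreal c1 * (\<integral>\<^sup>+\<omega>. S \<omega> \<partial>M) + 1)"
    unfolding F_def by (simp add: nn_integral_cmult nn_integral_add emeasure_space_1)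
  also have "\<dots> < \<infinity>" using S_fin by (simp add: ennreal_mult_less_top ennreal_add_less_top)
  finally show ?thesis .
qed

section \<open>Spectral radius below one from finite moments\<close>

text \<open>
  Minorant of the noise: the product of the \<open>m\<close> most recent squared innovations, each truncated at
  one. It is bounded by each of these squares and is a product over the times.
\<close>

definition floor_noise :: "nat \<Rightarrow> int \<Rightarrow> 'w \<Rightarrow> real" where
  "floor_noise m t \<omega> = (\<Prod>i<m. min ((\<epsilon> (t - int i) \<omega>)\<^sup>2) 1)"

lemma floor_noise_nonneg: "0 \<le> floor_noise m t \<omega>"
  unfolding floor_noise_def by (intro prod_nonneg) auto

lemma floor_noise_le_1: "floor_noise m t \<omega> \<le> 1"
  unfolding floor_noise_def by (intro prod_le_1) auto

lemma floor_noise_le: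
  assumes "i < m"
  shows "floor_noise m t \<omega> \<le> (\<epsilon> (t - int i) \<omega>)\<^sup>2"
proof -
  let ?f = "\<lambda>i. min ((\<epsilon> (t - int i) \<omega>)\<^sup>2) (1::real)"
  have "floor_noise m t \<omega> = ?f i * (\<Prod>i\<in>{..<m} - {i}. ?f i)"
    unfolding floor_noise_def using assms by (intro prod.remove) auto
  also have "\<dots> \<le> ?f i * 1"
    by (intro mult_left_mono prod_le_1) auto
  also have "\<dots> \<le> (\<epsilon> (t - int i) \<omega>)\<^sup>2" by simp
  finally show ?thesis .
qed

lemma floor_noise_meas [measurable]: "floor_noise m t \<in> borel_measurable M"
  unfolding floor_noise_def by measurable

lemma nn_integral_P_floor_noise:
  assumes nondeg: "\<not> (AE \<omega> in M. \<epsilon> 0 \<omega> = 0)"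
  shows "\<exists>e>0. \<forall>t n. (\<integral>\<^sup>+\<omega>. ennreal ((sum_mat (P t n \<omega>) * floor_noise m (t - int n) \<omega>) ^ r) \<partial>M) =
    ennreal (sum_mat (Pmean t n) * e)"
proof -
  define g where "g = (\<lambda>(u::int) x. ennreal (min (x\<^sup>2) 1 ^ r :: real))"
  have g: "g u \<in> borel_measurable borel" for u unfolding g_def by measurable
  define e0 where "e0 = (\<integral>\<^sup>+\<omega>. g 0 (\<epsilon> 0 \<omega>) \<partial>M)"
  have "e0 \<le> (\<integral>\<^sup>+\<omega>. 1 \<partial>M)"
    unfolding e0_def g_def by (intro nn_integral_mono) (auto intro!: power_le_one)
  then have fin: "e0 \<le> 1" by (simp add: emeasure_space_1)
  have "e0 \<noteq> 0"
  proof
    assume "e0 = 0"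
    then have "AE \<omega> in M. g 0 (\<epsilon> 0 \<omega>) = 0"
      unfolding e0_def by (subst (asm) nn_integral_0_iff_AE) (auto intro: measurable_compose[OF eps_meas g])
    then have "AE \<omega> in M. \<epsilon> 0 \<omega> = 0"
    proof eventually_elim
      case (elim \<omega>)
      then have "min ((\<epsilon> 0 \<omega>)\<^sup>2) 1 ^ r = 0"
        using ennreal_eq_0_iff[of "min ((\<epsilon> 0 \<omega>)\<^sup>2) 1 ^ r"] zero_le_power[of "min ((\<epsilon> 0 \<omega>)\<^sup>2) 1" r]
        by (simp add: g_def)
      then show ?case by (auto simp: min_def split: if_splits)
    qed
    with nondeg show False by simp
  qed
  define e where "e = enn2real e0"
  have e: "e0 = ennreal e" "e > 0"
    using fin \<open>e0 \<noteq> 0\<close> by (auto simp: e_def enn2real_positive_iff less_top[symmetric] neq_top_trans[OF _ fin] zero_less_iff_neq_zero)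
  have "(\<integral>\<^sup>+\<omega>. ennreal ((sum_mat (P t n \<omega>) * floor_noise m (t - int n) \<omega>) ^ r) \<partial>M) =
      ennreal (sum_mat (Pmean t n) * e ^ m)" for t n
  proof -
    define F where "F = (\<lambda>i. t - int n - int i) ` {..<m}"
    have inj: "inj_on (\<lambda>i. t - int n - int i) {..<m}" by (auto simp: inj_on_def)
    have "ennreal ((sum_mat (P t n \<omega>) * floor_noise m (t - int n) \<omega>) ^ r) =
        ennreal (sum_mat (P t n \<omega>) ^ r) * (\<Prod>u\<in>F. g u (\<epsilon> u \<omega>))" for \<omega>
    proof -
      have "(\<Prod>u\<in>F. g u (\<epsilon> u \<omega>)) = (\<Prod>i<m. ennreal (min ((\<epsilon> (t - int n - int i) \<omega>)\<^sup>2) 1 ^ r))"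
        unfolding F_def by (subst prod.reindex[OF inj]) (simp add: g_def)
      also have "\<dots> = ennreal (\<Prod>i<m. min ((\<epsilon> (t - int n - int i) \<omega>)\<^sup>2) 1 ^ r)"
        by (intro prod_ennreal) auto
      also have "(\<Prod>i<m. min ((\<epsilon> (t - int n - int i) \<omega>)\<^sup>2) 1 ^ r) = floor_noise m (t - int n) \<omega> ^ r"
        by (simp add: floor_noise_def prod_power_distrib)
      finally show ?thesis
        using sum_mat_nonneg[OF P_nonneg, of t n \<omega>] floor_noise_nonneg[of m "t - int n" \<omega>]
        by (simp add: power_mult_distrib ennreal_mult)
    qed
    then have "(\<integral>\<^sup>+\<omega>. ennreal ((sum_mat (P t n \<omega>) * floor_noise m (t - int n) \<omega>) ^ r) \<partial>M) =
        (\<integral>\<^sup>+\<omega>. ennreal (sum_mat (P t n \<omega>) ^ r) * (\<Prod>u\<in>F. g u (\<epsilon> u \<omega>)) \<partial>M)" by simp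
    also have "\<dots> = ennreal (sum_mat (Pmean t n)) * (\<Prod>u\<in>F. \<integral>\<^sup>+\<omega>. g u (\<epsilon> u \<omega>) \<partial>M)"
      by (rule nn_integral_sum_P) (auto simp: F_def g)
    also have "(\<Prod>u\<in>F. \<integral>\<^sup>+\<omega>. g u (\<epsilon> u \<omega>) \<partial>M) = (\<Prod>u\<in>F. e0)"
      using nn_integral_eps[OF g] by (intro prod.cong refl) (simp add: e0_def g_def)
    also have "\<dots> = ennreal (e ^ m)"
      using e inj by (simp add: F_def card_image ennreal_power)
    finally show ?thesis using e sum_Pmean_nonneg by (simp add: ennreal_mult)
  qed
  then show ?thesis using e(2) by (intro exI[of _ "e ^ m"]) auto
qed

lemma vec_sum_lower_iterate:
  assumes carrier: "\<And>t. u t \<in> carrier_vec d" and nonneg: "\<And>t. vec_nonneg (u t)"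
    and step: "\<And>t i. i < d \<Longrightarrow> (P t N \<omega> *\<^sub>v u (t - int N)) $ i + z t \<le> u t $ i"
  shows "(\<Sum>j<J. sum_mat (P t (N * j) \<omega>) * z (t - int (N * j))) \<le> vec_sum (u t)"
proof -
  have "(\<Sum>j<J. sum_mat (P t (N * j) \<omega>) * z (t - int (N * j))) +
      vec_sum (P t (N * J) \<omega> *\<^sub>v u (t - int (N * J))) \<le> vec_sum (u t)"
  proof (induction J)
    case 0
    then show ?case using carrier[of t] by (simp add: P_0)
  next
    case (Suc J)
    let ?n = "N * J" and ?t = "t - int (N * J)"
    let ?w = "P ?t N \<omega> *\<^sub>v u (?t - int N)"
    have w: "?w \<in> carrier_vec d" by (rule mult_mat_vec_carrier[OF P_carrier carrier])
    have eq: "N * Suc J = ?n + N" "t - int (N * Suc J) = ?t - int N" by (auto simp: algebra_simps)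
    have "P t (N * Suc J) \<omega> *\<^sub>v u (t - int (N * Suc J)) = P t ?n \<omega> *\<^sub>v ?w"
      unfolding eq(2) unfolding eq(1) P_add
      by (rule assoc_mult_mat_vec[OF P_carrier P_carrier carrier])
    then have "sum_mat (P t ?n \<omega>) * z ?t + vec_sum (P t (N * Suc J) \<omega> *\<^sub>v u (t - int (N * Suc J))) =
        (\<Sum>i<d. \<Sum>k<d. P t ?n \<omega> $$ (i, k) * (?w $ k + z ?t))"
      by (simp only: vec_sum_mult[OF P_carrier w] sum_mat_carrier[OF P_carrier])
         (simp add: sum.distrib sum_distrib_left sum_distrib_right distrib_left mult_ac)
    also have "\<dots> \<le> (\<Sum>i<d. \<Sum>k<d. P t ?n \<omega> $$ (i, k) * u ?t $ k)"
      using P_nonneg[of t ?n \<omega>] carrier_matD[OF P_carrier[of t ?n \<omega>]]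
      by (intro sum_mono mult_left_mono step) (auto simp: mat_nonneg_def)
    also have "\<dots> = vec_sum (P t ?n \<omega> *\<^sub>v u ?t)" by (rule vec_sum_mult[OF P_carrier carrier, symmetric])
    finally show ?case using Suc by simp
  qed
  moreover have "0 \<le> vec_sum (P t (N * J) \<omega> *\<^sub>v u (t - int (N * J)))"
    by (intro vec_sum_nonneg vec_nonneg_mult[OF P_carrier carrier P_nonneg nonneg])
  ultimately show ?thesis by linarith
qed

text \<open>
  The second half. If within \<open>s * l\<close> steps the noise contributes at least a multiple of
  \<open>floor_noise\<close> to every coordinate, then a finite moment of order \<open>r\<close> of a solution bounds the
  partial sums over \<open>j\<close> of the sizes of the \<open>l * j\<close>-th powers of the mean matrix of one period. Only the
  contribution of the innovations is used, so the solution itself need not be independent of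
  later innovations.
\<close>

theorem spectral_radius_less_1_if_moment_finite:
  assumes carrier: "\<And>t \<omega>. \<omega> \<in> space M \<Longrightarrow> u t \<omega> \<in> carrier_vec d"
    and nonneg: "AE \<omega> in M. \<forall>t. vec_nonneg (u t \<omega>)"
    and a: "a > 0"
    and nondeg: "\<not> (AE \<omega> in M. \<epsilon> 0 \<omega> = 0)"
    and lower: "AE \<omega> in M. \<forall>t. \<forall>i<d.
      (P t (s * l) \<omega> *\<^sub>v u (t - int (s * l)) \<omega>) $ i + a * floor_noise m t \<omega> \<le> u t \<omega> $ i"
    and fin: "(\<integral>\<^sup>+\<omega>. ennreal (vec_sum (u (int s) \<omega>) ^ r) \<partial>M) < \<infinity>"
  shows "real_spectral_radius (Pmean (int s) s) < 1"
proof -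
  let ?t = "int s" and ?N = "s * l"
  obtain K where K: "(\<integral>\<^sup>+\<omega>. ennreal (vec_sum (u ?t \<omega>) ^ r) \<partial>M) = ennreal K" "0 \<le> K"
    using fin by (metis ennreal_enn2real enn2real_nonneg infinity_ennreal_def)
  obtain e where e: "e > 0" and E: "\<And>t n. (\<integral>\<^sup>+\<omega>. ennreal ((sum_mat (P t n \<omega>) * floor_noise m (t - int n) \<omega>) ^ r) \<partial>M) =
      ennreal (sum_mat (Pmean t n) * e)"
    using nn_integral_P_floor_noise[OF nondeg] by blast
  define y where "y j \<omega> = sum_mat (P ?t (?N * j) \<omega>) * floor_noise m (?t - int (?N * j)) \<omega>" for j \<omega>
  have y0: "0 \<le> y j \<omega>" for j \<omega>
    unfolding y_def by (intro mult_nonneg_nonneg sum_mat_nonneg P_nonneg floor_noise_nonneg)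
  have [measurable]: "y j \<in> borel_measurable M" for j unfolding y_def by measurable
  have bound: "(\<Sum>j<J. sum_mat (Pmean ?t (?N * j))) \<le> K / (a ^ r * e)" for J
  proof -
    have "AE \<omega> in M. ennreal (a ^ r) * (\<Sum>j<J. ennreal (y j \<omega> ^ r)) \<le> ennreal (vec_sum (u ?t \<omega>) ^ r)"
      using nonneg lower AE_space
    proof eventually_elim
      case (elim \<omega>)
      have car: "\<And>t. u t \<omega> \<in> carrier_vec d" and nn_u: "\<And>t. vec_nonneg (u t \<omega>)"
        and low: "\<And>t i. i < d \<Longrightarrow>
          (P t ?N \<omega> *\<^sub>v u (t - int ?N) \<omega>) $ i + a * floor_noise m t \<omega> \<le> u t \<omega> $ i"
        using elim carrier by blast+
      have "(\<Sum>j<J. a * y j \<omega>) \<le> vec_sum (u ?t \<omega>)"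
        using vec_sum_lower_iterate[of "\<lambda>t. u t \<omega>" ?N \<omega> "\<lambda>t. a * floor_noise m t \<omega>" ?t J, OF car nn_u low]
        by (simp add: y_def mult_ac)
      then have "(\<Sum>j<J. a * y j \<omega>) ^ r \<le> vec_sum (u ?t \<omega>) ^ r"
        using y0 a by (intro power_mono sum_nonneg) auto
      moreover have "(\<Sum>j<J. (a * y j \<omega>) ^ r) \<le> (\<Sum>j<J. a * y j \<omega>) ^ r"
        using y0 a r_pos by (intro sum_power_le_power_sum) auto
      ultimately have "a ^ r * (\<Sum>j<J. y j \<omega> ^ r) \<le> vec_sum (u ?t \<omega>) ^ r"
        by (simp add: power_mult_distrib sum_distrib_left)
      moreover have "(\<Sum>j<J. ennreal (y j \<omega> ^ r)) = ennreal (\<Sum>j<J. y j \<omega> ^ r)"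
        using y0 by (intro sum_ennreal) auto
      ultimately show ?case using a by (simp add: ennreal_leI flip: ennreal_mult')
    qed
    then have "(\<integral>\<^sup>+\<omega>. ennreal (a ^ r) * (\<Sum>j<J. ennreal (y j \<omega> ^ r)) \<partial>M) \<le> ennreal K"
      unfolding K(1)[symmetric] by (rule nn_integral_mono_AE)
    also have "(\<integral>\<^sup>+\<omega>. ennreal (a ^ r) * (\<Sum>j<J. ennreal (y j \<omega> ^ r)) \<partial>M) =
        ennreal (a ^ r) * (\<Sum>j<J. ennreal (sum_mat (Pmean ?t (?N * j)) * e))"
      by (simp add: nn_integral_cmult nn_integral_sum) (simp only: y_def E)
    also have "(\<Sum>j<J. ennreal (sum_mat (Pmean ?t (?N * j)) * e)) =
        ennreal (\<Sum>j<J. sum_mat (Pmean ?t (?N * j)) * e)"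
      using e sum_Pmean_nonneg by (intro sum_ennreal) auto
    also have "ennreal (a ^ r) * \<dots> = ennreal (a ^ r * (\<Sum>j<J. sum_mat (Pmean ?t (?N * j)) * e))"
      using a by (simp add: ennreal_mult')
    finally have "a ^ r * (\<Sum>j<J. sum_mat (Pmean ?t (?N * j)) * e) \<le> K"
      using K(2) by (simp add: ennreal_le_iff)
    moreover have "(\<Sum>j<J. sum_mat (Pmean ?t (?N * j)) * e) = (\<Sum>j<J. sum_mat (Pmean ?t (?N * j))) * e"
      by (rule sum_distrib_right[symmetric])
    ultimately have "(\<Sum>j<J. sum_mat (Pmean ?t (?N * j))) * (a ^ r * e) \<le> K"
      by (simp only: mult_ac)
    then show ?thesis using a e by (simp add: pos_le_divide_eq)
  qed
  have "summable (\<lambda>j. sum_mat (Pmean ?t (?N * j)))"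
    by (rule summableI_nonneg_bounded[OF sum_Pmean_nonneg bound])
  then have "(\<lambda>j. sum_mat (Pmean ?t (s * (l * j)))) \<longlonglongrightarrow> 0"
    by (intro summable_LIMSEQ_zero) (simp add: mult.assoc)
  then have "(\<lambda>j. sum_mat (Pmean ?t s ^\<^sub>m (l * j))) \<longlonglongrightarrow> 0"
    by (simp only: Pmean_pow)
  then show ?thesis
    using d_pos by (intro powers_tendsto_0_imp_spectral_radius_less_1[OF Pmean_carrier _ Pmean_nonneg]) auto
qed

end

section \<open>The periodic GARCH recursion, season by season\<close>

text \<open>The season of a time: \<open>season s (s * t + v) = v\<close> for \<open>v = 1, \<dots>, s\<close>.\<close>

definition season :: "nat \<Rightarrow> int \<Rightarrow> nat" where
  "season s t = nat ((t - 1) mod int s) + 1"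

lemma season_range: "s \<ge> 1 \<Longrightarrow> season s t \<in> {1..s}"
proof -
  assume "s \<ge> 1"
  then have "nat ((t - 1) mod int s) < s" by (simp add: nat_less_iff)
  then show ?thesis by (simp add: season_def)
qed

lemma season_periodic: "season s (t + int s) = season s t"
  by (simp add: season_def add.commute[of t] add_diff_eq[symmetric])

lemma season_div:
  assumes "v \<in> {1..s}"
  shows "season s (int s * t + int v) = v" "(int s * t + int v - 1) div int s = t"
proof -
  have eq: "int s * t + int v - 1 = int (v - 1) + t * int s" using assms by (simp add: of_nat_diff)
  have "v - 1 < s" using assms by auto
  then show "season s (int s * t + int v) = v" "(int s * t + int v - 1) div int s = t"
    using assms unfolding season_def eq by (auto simp: zmod_int[symmetric] of_nat_diff)
qed

lemma season_decomp:
  assumes "s \<ge> 1"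
  shows "t = int s * ((t - 1) div int s) + int (season s t)"
  using assms mult_div_mod_eq[of "int s" "t - 1"] by (simp add: season_def)

lemma phi_carrier [simp]: "phi p q \<alpha> \<beta> v e \<in> carrier_mat (p + q) (p + q)"
  unfolding phi_def by (rule four_block_carrier_mat) auto

text \<open>The coefficient with which coordinate \<open>j\<close> of the state enters the volatility.\<close>

definition coef :: "nat \<Rightarrow> (nat \<Rightarrow> nat \<Rightarrow> real) \<Rightarrow> (nat \<Rightarrow> nat \<Rightarrow> real) \<Rightarrow> nat \<Rightarrow> nat \<Rightarrow> real" where
  "coef p \<alpha> \<beta> v j = (if j < p then \<alpha> (j + 1) v else \<beta> (j - p + 1) v)"

lemma phi_index:
  assumes "p \<ge> 1" "q \<ge> 1" "i < p + q" "j < p + q"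
  shows "phi p q \<alpha> \<beta> v e $$ (i, j) =
    (if i = 0 then coef p \<alpha> \<beta> v j * e $ (v - 1) else if i = p then coef p \<alpha> \<beta> v j
     else if i = j + 1 then 1 else 0)"
  unfolding phi_def coef_def using assms
  by (subst index_mat_four_block) auto

lemma phi_cong:
  assumes "e $ (v - 1) = e' $ (v - 1)"
  shows "phi p q \<alpha> \<beta> v e = phi p q \<alpha> \<beta> v e'"
  unfolding phi_def by (simp only: assms)

lemma B_season_cong:
  assumes "e $ (v - 1) = e' $ (v - 1)"
  shows "B_season p q \<alpha> v e = B_season p q \<alpha> v e'"
  unfolding B_season_def by (simp only: assms)

lemma B_season_carrier [simp]: "B_season p q \<alpha> v e \<in> carrier_vec (p + q)"
  by (simp add: B_season_def)

lemma sum_lessThan_add: "(\<Sum>j<m + n. f j) = (\<Sum>j<m. f j) + (\<Sum>j<n. f (m + j :: nat) :: 'a :: comm_monoid_add)"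
  by (induction n) (auto simp: add.assoc)

lemma block_index:
  fixes d :: nat
  assumes "v \<in> {1..s}" "i < d"
  shows "d * (v - 1) + i < d * s" "(d * (v - 1) + i) div d = v - 1" "(d * (v - 1) + i) mod d = i"
proof -
  have "d * (v - 1) + i < d * (v - 1) + d" using assms by simp
  also have "\<dots> = d * v" using assms by (cases v) auto
  also have "\<dots> \<le> d * s" using assms by simp
  finally show "d * (v - 1) + i < d * s" .
qed (use assms in auto)

text \<open>The last \<open>d\<close> of the \<open>d * s\<close> coordinates, the block of season \<open>s\<close>.\<close>

definition last_block :: "nat \<Rightarrow> nat \<Rightarrow> real vec \<Rightarrow> real vec" where
  "last_block d s y = vec d (\<lambda>j. y $ (d * (s - 1) + j))"

lemma A_mat_mult_block:
  assumes s: "s \<ge> 1" and v: "v \<in> {1..s}" and i: "i < p + q" and y: "y \<in> carrier_vec ((p + q) * s)"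
  shows "(A_mat s p q \<alpha> \<beta> e *\<^sub>v y) $ ((p + q) * (v - 1) + i) =
    (mat_prod (p + q) (\<lambda>k. phi p q \<alpha> \<beta> (v - k) e) v *\<^sub>v last_block (p + q) s y) $ i"
proof -
  let ?d = "p + q" and ?Q = "mat_prod (p + q) (\<lambda>k. phi p q \<alpha> \<beta> (v - k) e) v"
  note b = block_index[OF v i]
  have A: "A_mat s p q \<alpha> \<beta> e \<in> carrier_mat (?d * s) (?d * s)" by (simp add: A_mat_def Let_def)
  have ds: "?d * s = ?d * (s - 1) + ?d" using s by (cases s) auto
  have Q: "?Q \<in> carrier_mat ?d ?d" by (intro mat_prod_carrier) simp
  have "(A_mat s p q \<alpha> \<beta> e *\<^sub>v y) $ (?d * (v - 1) + i) =
      (\<Sum>j<?d * s. A_mat s p q \<alpha> \<beta> e $$ (?d * (v - 1) + i, j) * y $ j)"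
    by (rule mult_mat_vec_index[OF A y b(1)])
  also have "\<dots> = (\<Sum>j<?d * s. (if j < ?d * (s - 1) then 0 else ?Q $$ (i, j - ?d * (s - 1))) * y $ j)"
    using b v by (intro sum.cong refl) (simp add: A_mat_def Let_def)
  also have "\<dots> = (\<Sum>j<?d. ?Q $$ (i, j) * y $ (?d * (s - 1) + j))"
    unfolding ds sum_lessThan_add by simp
  also have "\<dots> = (?Q *\<^sub>v last_block ?d s y) $ i"
    by (subst mult_mat_vec_index[OF Q _ i]) (auto simp: last_block_def)
  finally show ?thesis .
qed

text \<open>The block of season \<open>v\<close> of the stacked noise vector \<open>B_vec\<close>.\<close>

definition B_block ::
    "nat \<Rightarrow> nat \<Rightarrow> (nat \<Rightarrow> nat \<Rightarrow> real) \<Rightarrow> (nat \<Rightarrow> nat \<Rightarrow> real) \<Rightarrow> nat \<Rightarrow> real vec \<Rightarrow> real vec" where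
  "B_block p q \<alpha> \<beta> v e = vec (p + q) (\<lambda>i. \<Sum>k = 1..v.
     (mat_prod (p + q) (\<lambda>l. phi p q \<alpha> \<beta> (v - l) e) (v - k) *\<^sub>v B_season p q \<alpha> k e) $ i)"

lemma B_block_Suc:
  "B_block p q \<alpha> \<beta> (Suc v) e =
    phi p q \<alpha> \<beta> (Suc v) e *\<^sub>v B_block p q \<alpha> \<beta> v e + B_season p q \<alpha> (Suc v) e"
proof (rule eq_vecI)
  let ?d = "p + q" and ?F = "phi p q \<alpha> \<beta> (Suc v) e"
  let ?R = "\<lambda>v k. mat_prod ?d (\<lambda>l. phi p q \<alpha> \<beta> (v - l) e) (v - k)"
  let ?b = "\<lambda>k. B_season p q \<alpha> k e"
  fix i assume "i < dim_vec (?F *\<^sub>v B_block p q \<alpha> \<beta> v e + ?b (Suc v))"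
  then have i: "i < ?d" by (simp add: B_season_def)
  have R: "?R v k \<in> carrier_mat ?d ?d" for v k by (intro mat_prod_carrier) simp
  have step: "(?R (Suc v) k *\<^sub>v ?b k) $ i = (\<Sum>j<?d. ?F $$ (i, j) * (?R v k *\<^sub>v ?b k) $ j)"
    if "k \<in> {1..v}" for k
  proof -
    have "Suc v - k = Suc (v - k)" using that by auto
    then have "?R (Suc v) k = mat_prod ?d (\<lambda>l. phi p q \<alpha> \<beta> (Suc v - l) e) (Suc (v - k))" by (simp only:)
    also have "\<dots> = ?F * ?R v k" by (subst mat_prod_Suc_left) simp_all
    finally have "?R (Suc v) k *\<^sub>v ?b k = ?F *\<^sub>v (?R v k *\<^sub>v ?b k)"
      using assoc_mult_mat_vec[OF phi_carrier R B_season_carrier] by simp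
    then show ?thesis
      using mult_mat_vec_index[OF phi_carrier mult_mat_vec_carrier[OF R B_season_carrier] i] by simp
  qed
  have "B_block p q \<alpha> \<beta> (Suc v) e $ i = (\<Sum>k = 1..v. (?R (Suc v) k *\<^sub>v ?b k) $ i) + (?R (Suc v) (Suc v) *\<^sub>v ?b (Suc v)) $ i"
    using i by (simp add: B_block_def)
  also have "(?R (Suc v) (Suc v) *\<^sub>v ?b (Suc v)) $ i = ?b (Suc v) $ i"
    using i by simp
  also have "(\<Sum>k = 1..v. (?R (Suc v) k *\<^sub>v ?b k) $ i) = (\<Sum>k = 1..v. \<Sum>j<?d. ?F $$ (i, j) * (?R v k *\<^sub>v ?b k) $ j)"
    by (rule sum.cong[OF refl step])
  also have "\<dots> = (\<Sum>j<?d. ?F $$ (i, j) * B_block p q \<alpha> \<beta> v e $ j)"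
    by (subst sum.swap) (simp add: B_block_def sum_distrib_left)
  also have "\<dots> = (?F *\<^sub>v B_block p q \<alpha> \<beta> v e) $ i"
    by (rule mult_mat_vec_index[OF phi_carrier _ i, symmetric]) (simp add: B_block_def)
  finally show "B_block p q \<alpha> \<beta> (Suc v) e $ i =
      (?F *\<^sub>v B_block p q \<alpha> \<beta> v e + ?b (Suc v)) $ i" using i by (simp add: B_season_def)
qed (simp add: B_block_def B_season_def)

text \<open>The state in season \<open>v\<close> of a period that starts from the state \<open>z\<close>.\<close>

definition seasonal_state ::
    "nat \<Rightarrow> nat \<Rightarrow> (nat \<Rightarrow> nat \<Rightarrow> real) \<Rightarrow> (nat \<Rightarrow> nat \<Rightarrow> real) \<Rightarrow> nat \<Rightarrow> real vec \<Rightarrow> real vec \<Rightarrow> real vec" where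
  "seasonal_state p q \<alpha> \<beta> v e z =
     mat_prod (p + q) (\<lambda>k. phi p q \<alpha> \<beta> (v - k) e) v *\<^sub>v z + B_block p q \<alpha> \<beta> v e"

lemma seasonal_state_0:
  assumes "z \<in> carrier_vec (p + q)"
  shows "seasonal_state p q \<alpha> \<beta> 0 e z = z"
  using assms by (intro eq_vecI) (auto simp: seasonal_state_def B_block_def)

lemma seasonal_state_Suc:
  assumes z: "z \<in> carrier_vec (p + q)"
  shows "seasonal_state p q \<alpha> \<beta> (Suc v) e z =
    phi p q \<alpha> \<beta> (Suc v) e *\<^sub>v seasonal_state p q \<alpha> \<beta> v e z + B_season p q \<alpha> (Suc v) e"
proof -
  let ?d = "p + q" and ?F = "phi p q \<alpha> \<beta> (Suc v) e"
  let ?Q = "mat_prod ?d (\<lambda>k. phi p q \<alpha> \<beta> (v - k) e) v" and ?b = "B_block p q \<alpha> \<beta> v e"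
  have Q: "?Q \<in> carrier_mat ?d ?d" by (intro mat_prod_carrier) simp
  have b: "?b \<in> carrier_vec ?d" by (simp add: B_block_def)
  have "mat_prod ?d (\<lambda>k. phi p q \<alpha> \<beta> (Suc v - k) e) (Suc v) = ?F * ?Q"
    by (subst mat_prod_Suc_left) simp_all
  then have "seasonal_state p q \<alpha> \<beta> (Suc v) e z =
      ?F *\<^sub>v (?Q *\<^sub>v z) + (?F *\<^sub>v ?b + B_season p q \<alpha> (Suc v) e)"
    using assoc_mult_mat_vec[OF phi_carrier Q z] by (simp only: seasonal_state_def B_block_Suc)
  also have "\<dots> = (?F *\<^sub>v (?Q *\<^sub>v z) + ?F *\<^sub>v ?b) + B_season p q \<alpha> (Suc v) e"
    using Q b z by (intro assoc_add_vec[of _ ?d, symmetric] mult_mat_vec_carrier[of _ ?d ?d]) auto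
  also have "?F *\<^sub>v (?Q *\<^sub>v z) + ?F *\<^sub>v ?b = ?F *\<^sub>v (?Q *\<^sub>v z + ?b)"
    by (rule mult_add_distrib_mat_vec[symmetric, OF phi_carrier mult_mat_vec_carrier[OF Q z] b])
  finally show ?thesis by (simp only: seasonal_state_def)
qed

text \<open>The block of season \<open>v\<close> of one step of the stacked recursion.\<close>

lemma stacked_step_block:
  assumes s: "s \<ge> 1" and v: "v \<in> {1..s}" and i: "i < p + q" and y: "y \<in> carrier_vec ((p + q) * s)"
  shows "(A_mat s p q \<alpha> \<beta> e *\<^sub>v y + B_vec s p q \<alpha> \<beta> e) $ ((p + q) * (v - 1) + i) =
    seasonal_state p q \<alpha> \<beta> v e (last_block (p + q) s y) $ i"
proof -
  let ?d = "p + q" and ?Q = "mat_prod (p + q) (\<lambda>k. phi p q \<alpha> \<beta> (v - k) e) v"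
  note b = block_index[OF v i]
  have "v - 1 + 1 = v" using v by simp
  then have "B_vec s p q \<alpha> \<beta> e $ (?d * (v - 1) + i) = B_block p q \<alpha> \<beta> v e $ i"
    by (simp only: B_vec_def B_block_def Let_def index_vec[OF b(1)] index_vec[OF i] b(2,3))
  moreover have "dim_vec (B_vec s p q \<alpha> \<beta> e) = ?d * s" by (simp add: B_vec_def Let_def)
  moreover have "?Q \<in> carrier_mat ?d ?d" by (intro mat_prod_carrier) simp
  ultimately show ?thesis
    using A_mat_mult_block[OF s v i y, of \<alpha> \<beta> e] b i
    by (simp del: index_mult_mat_vec add: seasonal_state_def B_block_def)
qed

text \<open>The state at a single time: the block of \<open>Y\<close> belonging to that time.\<close>

definition block_state :: "nat \<Rightarrow> nat \<Rightarrow> (int \<Rightarrow> real vec) \<Rightarrow> int \<Rightarrow> real vec" where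
  "block_state d s Y t = vec d (\<lambda>i. Y ((t - 1) div int s) $ (d * (season s t - 1) + i))"

lemma block_state_carrier [simp]: "block_state d s Y t \<in> carrier_vec d"
  by (simp add: block_state_def)

lemma block_state_season:
  assumes "v \<in> {1..s}"
  shows "block_state d s Y (int s * t + int v) = vec d (\<lambda>i. Y t $ (d * (v - 1) + i))"
  using season_div[OF assms] by (simp add: block_state_def)

text \<open>
  The coefficients of the one-time recursion as functions of the time and of a single innovation
  \<open>x\<close>. The vector argument of \<open>phi\<close> is read in coordinate \<open>v - 1\<close> only, so a constant vector will do.
\<close>

definition G_time ::
    "nat \<Rightarrow> nat \<Rightarrow> nat \<Rightarrow> (nat \<Rightarrow> nat \<Rightarrow> real) \<Rightarrow> (nat \<Rightarrow> nat \<Rightarrow> real) \<Rightarrow> int \<Rightarrow> real \<Rightarrow> real mat" where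
  "G_time s p q \<alpha> \<beta> t x = phi p q \<alpha> \<beta> (season s t) (vec s (\<lambda>_. x\<^sup>2))"

definition B_time :: "nat \<Rightarrow> nat \<Rightarrow> nat \<Rightarrow> (nat \<Rightarrow> nat \<Rightarrow> real) \<Rightarrow> int \<Rightarrow> real \<Rightarrow> real vec" where
  "B_time s p q \<alpha> t x = B_season p q \<alpha> (season s t) (vec s (\<lambda>_. x\<^sup>2))"

lemma G_time_eta_vec:
  assumes "v \<in> {1..s}"
  shows "G_time s p q \<alpha> \<beta> (int s * t + int v) (\<epsilon> (int s * t + int v) \<omega>) =
    phi p q \<alpha> \<beta> v (eta_vec s \<epsilon> t \<omega>)"
  unfolding G_time_def season_div(1)[OF assms]
  using assms by (intro phi_cong) (auto simp: eta_vec_def of_nat_diff)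

lemma B_time_eta_vec:
  assumes "v \<in> {1..s}"
  shows "B_time s p q \<alpha> (int s * t + int v) (\<epsilon> (int s * t + int v) \<omega>) =
    B_season p q \<alpha> v (eta_vec s \<epsilon> t \<omega>)"
  unfolding B_time_def season_div(1)[OF assms]
  using assms by (intro B_season_cong) (auto simp: eta_vec_def of_nat_diff)

lemma block_state_step:
  fixes Y :: "int \<Rightarrow> real vec"
  assumes s: "s \<ge> 1"
    and Y: "\<And>t. Y t \<in> carrier_vec ((p + q) * s)"
    and rec: "\<And>t. Y t = A_mat s p q \<alpha> \<beta> (eta_vec s \<epsilon> t \<omega>) *\<^sub>v Y (t - 1) + B_vec s p q \<alpha> \<beta> (eta_vec s \<epsilon> t \<omega>)"
  shows "block_state (p + q) s Y t = G_time s p q \<alpha> \<beta> t (\<epsilon> t \<omega>) *\<^sub>v block_state (p + q) s Y (t - 1) +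
    B_time s p q \<alpha> t (\<epsilon> t \<omega>)"
proof -
  let ?d = "p + q"
  define k v where "k = (t - 1) div int s" and "v = season s t"
  have t: "t = int s * k + int v" unfolding k_def v_def by (rule season_decomp[OF s])
  have v: "v \<in> {1..s}" unfolding v_def by (rule season_range[OF s])
  let ?e = "eta_vec s \<epsilon> k \<omega>" and ?z = "last_block (p + q) s (Y (k - 1))"
  have z: "?z \<in> carrier_vec ?d" by (simp add: last_block_def)
  have state: "block_state ?d s Y (int s * k + int w) = seasonal_state p q \<alpha> \<beta> w ?e ?z" if "w \<in> {1..s}" for w
  proof (rule eq_vecI)
    show "dim_vec (block_state ?d s Y (int s * k + int w)) = dim_vec (seasonal_state p q \<alpha> \<beta> w ?e ?z)"
      by (simp add: block_state_def seasonal_state_def B_block_def)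
    fix i assume "i < dim_vec (seasonal_state p q \<alpha> \<beta> w ?e ?z)"
    then have i: "i < ?d" by (simp add: seasonal_state_def B_block_def)
    have "Y k $ (?d * (w - 1) + i) = seasonal_state p q \<alpha> \<beta> w ?e ?z $ i"
      by (subst rec) (rule stacked_step_block[OF s that i Y])
    then show "block_state ?d s Y (int s * k + int w) $ i = seasonal_state p q \<alpha> \<beta> w ?e ?z $ i"
      using i by (simp add: block_state_season[OF that])
  qed
  have "block_state ?d s Y (t - 1) = seasonal_state p q \<alpha> \<beta> (v - 1) ?e ?z"
  proof (cases "v = 1")
    case True
    have "t - 1 = int s * (k - 1) + int s" using True t by (simp add: algebra_simps)
    then have "block_state ?d s Y (t - 1) = ?z"
      using s block_state_season[of s s ?d Y "k - 1"] by (simp add: last_block_def)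
    then show ?thesis using True z by (simp add: seasonal_state_0)
  next
    case False
    then have "t - 1 = int s * k + int (v - 1)" "v - 1 \<in> {1..s}" using v t by auto
    then show ?thesis using state by simp
  qed
  moreover have "block_state ?d s Y t = seasonal_state p q \<alpha> \<beta> (Suc (v - 1)) ?e ?z"
    using state[OF v] v t by simp
  ultimately have "block_state ?d s Y t =
      phi p q \<alpha> \<beta> (Suc (v - 1)) ?e *\<^sub>v block_state ?d s Y (t - 1) + B_season p q \<alpha> (Suc (v - 1)) ?e"
    by (simp only: seasonal_state_Suc[OF z])
  moreover have "Suc (v - 1) = v" using v by simp
  ultimately show ?thesis
    using G_time_eta_vec[OF v, of p q \<alpha> \<beta> k \<epsilon> \<omega>] B_time_eta_vec[OF v, of p q \<alpha> k \<epsilon> \<omega>] t by simp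
qed

lemma G_time_carrier [simp]: "G_time s p q \<alpha> \<beta> t x \<in> carrier_mat (p + q) (p + q)"
  by (simp add: G_time_def)

lemma B_time_carrier [simp]: "B_time s p q \<alpha> t x \<in> carrier_vec (p + q)"
  by (simp add: B_time_def)

lemma dim_B_time [simp]: "dim_vec (B_time s p q \<alpha> t x) = p + q"
  by (simp add: B_time_def B_season_def)

section \<open>Moments of the periodic GARCH process\<close>

text \<open>Exponents \<open>r \<ge> 2\<close> suffice: \<open>r \<le> 2 (r - 1)\<close> then ensures finite moments of order \<open>2 r\<close>.\<close>

locale pgarch = prob_space M for M :: "'w measure" +
  fixes s p q r :: nat and \<alpha> \<beta> :: "nat \<Rightarrow> nat \<Rightarrow> real" and \<epsilon> :: "int \<Rightarrow> 'w \<Rightarrow> real"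
  assumes s: "s \<ge> 1" and p: "p \<ge> 1" and q: "q \<ge> 1"
    and coeffs: "pgarch_coeffs s p q \<alpha> \<beta>"
    and innov: "innovations M \<epsilon>"
    and r: "r \<ge> 2"
    and kap: "kappa M \<epsilon> (2 * (r - 1)) < \<infinity>"
begin

abbreviation "d \<equiv> p + q"
abbreviation "G \<equiv> G_time s p q \<alpha> \<beta>"
abbreviation "B \<equiv> B_time s p q \<alpha>"

lemma season: "season s t \<in> {1..s}"
  by (rule season_range[OF s])

lemma intercept_pos: "\<alpha> 0 (season s t) > 0"
  using coeffs season[of t] by (auto simp: pgarch_coeffs_def)

lemma coef_nonneg:
  assumes "j < d"
  shows "0 \<le> coef p \<alpha> \<beta> (season s t) j"
proof (cases "j < p")
  case True
  then have "j + 1 \<in> {1..p}" by simp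
  then show ?thesis using coeffs season[of t] True unfolding pgarch_coeffs_def coef_def by simp
next
  case False
  then have "j - p + 1 \<in> {1..q}" using assms by auto
  then show ?thesis using coeffs season[of t] False unfolding pgarch_coeffs_def coef_def by simp
qed

lemma G_index:
  assumes "i < d" "j < d"
  shows "G t x $$ (i, j) = (if i = 0 then coef p \<alpha> \<beta> (season s t) j * x\<^sup>2
     else if i = p then coef p \<alpha> \<beta> (season s t) j else if i = j + 1 then 1 else 0)"
proof -
  have "season s t - 1 < s" using season[of t] by auto
  then show ?thesis unfolding G_time_def phi_index[OF p q assms] by simp
qed

lemma B_index:
  assumes "i < d"
  shows "B t x $ i = (if i = 0 then \<alpha> 0 (season s t) * x\<^sup>2 else if i = p then \<alpha> 0 (season s t) else 0)"
proof -
  have "season s t - 1 < s" using season[of t] by auto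
  then show ?thesis using assms by (simp add: B_time_def B_season_def)
qed

text \<open>A crude constant for the quadratic growth of both coefficients.\<close>

definition growth :: real where
  "growth = real d * real d * (1 + (\<Sum>v = 1..s. \<Sum>j<d. \<bar>coef p \<alpha> \<beta> v j\<bar>)) + real d * (\<Sum>v = 1..s. \<bar>\<alpha> 0 v\<bar>)"

lemma coef_le:
  assumes "j < d"
  shows "coef p \<alpha> \<beta> (season s t) j \<le> (\<Sum>v = 1..s. \<Sum>j<d. \<bar>coef p \<alpha> \<beta> v j\<bar>)"
proof -
  have "coef p \<alpha> \<beta> (season s t) j \<le> \<bar>coef p \<alpha> \<beta> (season s t) j\<bar>" by simp
  also have "\<dots> \<le> (\<Sum>j<d. \<bar>coef p \<alpha> \<beta> (season s t) j\<bar>)"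
    using assms by (intro member_le_sum[of j _ "\<lambda>j. \<bar>coef p \<alpha> \<beta> (season s t) j\<bar>"]) auto
  also have "\<dots> \<le> (\<Sum>v = 1..s. \<Sum>j<d. \<bar>coef p \<alpha> \<beta> v j\<bar>)"
    using season by (intro member_le_sum[of _ _ "\<lambda>v. \<Sum>j<d. \<bar>coef p \<alpha> \<beta> v j\<bar>"]) (auto intro: sum_nonneg)
  finally show ?thesis .
qed

lemma intercept_le: "\<alpha> 0 (season s t) \<le> (\<Sum>v = 1..s. \<bar>\<alpha> 0 v\<bar>)"
proof -
  have "\<alpha> 0 (season s t) \<le> \<bar>\<alpha> 0 (season s t)\<bar>" by simp
  also have "\<dots> \<le> (\<Sum>v = 1..s. \<bar>\<alpha> 0 v\<bar>)"
    using season by (intro member_le_sum[of _ _ "\<lambda>v. \<bar>\<alpha> 0 v\<bar>"]) auto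
  finally show ?thesis .
qed

lemma G_growth: "sum_mat (G t x) \<le> growth * (1 + x\<^sup>2)"
proof -
  define K where "K = (\<Sum>v = 1..s. \<Sum>j<d. \<bar>coef p \<alpha> \<beta> v j\<bar>)"
  have K0: "0 \<le> K" unfolding K_def by (intro sum_nonneg) auto
  have "G t x $$ (i, j) \<le> (1 + K) * (1 + x\<^sup>2)" if ij: "i < d" "j < d" for i j
  proof -
    define w where "w = coef p \<alpha> \<beta> (season s t) j"
    have w: "0 \<le> w" "w \<le> K" unfolding w_def K_def using coef_nonneg coef_le ij by auto
    have "G t x $$ (i, j) \<le> 1 + w + w * x\<^sup>2"
      using w unfolding G_index[OF ij] by (auto simp flip: w_def)
    also have "\<dots> \<le> 1 + K + K * x\<^sup>2" using w by (intro add_mono mult_right_mono) auto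
    also have "\<dots> \<le> (1 + K) * (1 + x\<^sup>2)" by (simp add: algebra_simps)
    finally show ?thesis .
  qed
  then have "sum_mat (G t x) \<le> (\<Sum>i<d. \<Sum>j<d. (1 + K) * (1 + x\<^sup>2))"
    unfolding sum_mat_carrier[OF G_time_carrier] by (intro sum_mono) auto
  also have "\<dots> = (real d * real d * (1 + K)) * (1 + x\<^sup>2)" by simp
  also have "\<dots> \<le> growth * (1 + x\<^sup>2)"
    unfolding growth_def K_def by (intro mult_right_mono) (auto intro!: mult_nonneg_nonneg sum_nonneg)
  finally show ?thesis .
qed

lemma B_growth: "vec_sum (B t x) \<le> growth * (1 + x\<^sup>2)"
proof -
  define A where "A = (\<Sum>v = 1..s. \<bar>\<alpha> 0 v\<bar>)"
  have "B t x $ i \<le> A * (1 + x\<^sup>2)" if i: "i < d" for i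
  proof -
    define w where "w = \<alpha> 0 (season s t)"
    have w: "0 \<le> w" "w \<le> A" unfolding w_def A_def using intercept_pos[of t] intercept_le[of t] by auto
    have "B t x $ i \<le> w + w * x\<^sup>2"
      using w unfolding B_index[OF i] by (auto simp flip: w_def)
    also have "\<dots> \<le> A + A * x\<^sup>2" using w by (intro add_mono mult_right_mono) auto
    finally show ?thesis by (simp add: algebra_simps)
  qed
  then have "vec_sum (B t x) \<le> (\<Sum>i<d. A * (1 + x\<^sup>2))"
    unfolding vec_sum_carrier[OF B_time_carrier] by (intro sum_mono) auto
  also have "\<dots> = (real d * A) * (1 + x\<^sup>2)" by simp
  also have "\<dots> \<le> growth * (1 + x\<^sup>2)"
    unfolding growth_def A_def by (intro mult_right_mono) (auto intro!: mult_nonneg_nonneg add_nonneg_nonneg sum_nonneg)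
  finally show ?thesis .
qed

lemma innovation_moment: "integrable M (\<lambda>\<omega>. (1 + (\<epsilon> 0 \<omega>)\<^sup>2) ^ r)"
proof (rule integrableI_bounded)
  have "has_bochner_integral M (\<epsilon> 0) 0" using innov by (simp add: innovations_def)
  then have [measurable]: "\<epsilon> 0 \<in> borel_measurable M" by (auto simp: has_bochner_integral_iff)
  show "(\<lambda>\<omega>. (1 + (\<epsilon> 0 \<omega>)\<^sup>2) ^ r) \<in> borel_measurable M" by measurable
  have le: "norm ((1 + x\<^sup>2) ^ r) \<le> 2 ^ r * (2 + x ^ (2 * (2 * (r - 1))))" for x :: real
  proof -
    have "(1 + x\<^sup>2) ^ r \<le> 2 ^ r * (1 ^ r + (x\<^sup>2) ^ r)" by (rule power_add_le) auto
    also have "(x\<^sup>2) ^ r \<le> 1 + (x\<^sup>2) ^ (2 * (r - 1))"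
    proof (cases "x\<^sup>2 \<le> 1")
      case True
      then have "(x\<^sup>2) ^ r \<le> 1" by (rule power_le_one[OF zero_le_power2])
      moreover have "0 \<le> (x\<^sup>2) ^ (2 * (r - 1))" by (rule zero_le_power) simp
      ultimately show ?thesis by linarith
    next
      case False
      have "r \<le> 2 * (r - 1)" using r by simp
      then have "(x\<^sup>2) ^ r \<le> (x\<^sup>2) ^ (2 * (r - 1))" using False by (intro power_increasing) auto
      then show ?thesis by linarith
    qed
    finally have "(1 + x\<^sup>2) ^ r \<le> 2 ^ r * (1 + (1 + (x\<^sup>2) ^ (2 * (r - 1))))" by simp
    then show ?thesis by (simp add: power_mult[symmetric])
  qed
  have "(\<integral>\<^sup>+\<omega>. ennreal (norm ((1 + (\<epsilon> 0 \<omega>)\<^sup>2) ^ r)) \<partial>M) \<le>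
      (\<integral>\<^sup>+\<omega>. ennreal (2 ^ r) * (2 + ennreal (\<epsilon> 0 \<omega> ^ (2 * (2 * (r - 1))))) \<partial>M)"
  proof (intro nn_integral_mono)
    fix \<omega>
    have "0 \<le> \<epsilon> 0 \<omega> ^ (2 * (2 * (r - 1)))" by (simp add: power_mult)
    then have eq: "ennreal (2 ^ r * (2 + \<epsilon> 0 \<omega> ^ (2 * (2 * (r - 1))))) =
        ennreal (2 ^ r) * (2 + ennreal (\<epsilon> 0 \<omega> ^ (2 * (2 * (r - 1)))))"
      by (subst ennreal_mult, simp, simp, subst ennreal_plus, simp_all)
    show "ennreal (norm ((1 + (\<epsilon> 0 \<omega>)\<^sup>2) ^ r)) \<le>
        ennreal (2 ^ r) * (2 + ennreal (\<epsilon> 0 \<omega> ^ (2 * (2 * (r - 1)))))"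
      unfolding eq[symmetric] by (rule ennreal_leI[OF le])
  qed
  also have "\<dots> = ennreal (2 ^ r) * (2 + kappa M \<epsilon> (2 * (r - 1)))"
    by (simp add: nn_integral_cmult nn_integral_add emeasure_space_1 kappa_def)
  also have "\<dots> < \<infinity>" using kap by (simp add: ennreal_mult_less_top ennreal_add_less_top)
  finally show "(\<integral>\<^sup>+\<omega>. ennreal (norm ((1 + (\<epsilon> 0 \<omega>)\<^sup>2) ^ r)) \<partial>M) < \<infinity>" .
qed

sublocale rec: nonneg_affine_recursion M d r s \<epsilon> G B growth
proof
  show "d > 0" "r > 0" "s > 0" using p r s by auto
  show "indep_vars (\<lambda>_. borel) \<epsilon> UNIV" "distr M borel (\<epsilon> t) = distr M borel (\<epsilon> 0)" for t
    using innov unfolding innovations_def by blast+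
  show "G t x \<in> carrier_mat d d" "B t x \<in> carrier_vec d" for t x by simp_all
  show "mat_nonneg (G t x)" for t x
    using carrier_matD[OF G_time_carrier[of s p q \<alpha> \<beta> t x]] coef_nonneg[of _ t]
    by (auto simp: mat_nonneg_def G_index)
  show "vec_nonneg (B t x)" for t x
    using intercept_pos[of t]
    by (auto simp: vec_nonneg_def B_index less_imp_le)
  show "(\<lambda>x. G t x $$ (i, j)) \<in> borel_measurable borel" if "i < d" "j < d" for t i j
    unfolding G_index[OF that] by measurable
  show "(\<lambda>x. B t x $ i) \<in> borel_measurable borel" if "i < d" for t i
    unfolding B_index[OF that] by measurable
  show "G (t + int s) = G t" for t by (simp add: G_time_def season_periodic fun_eq_iff)
  show "sum_mat (G t x) \<le> growth * (1 + x\<^sup>2)" "vec_sum (B t x) \<le> growth * (1 + x\<^sup>2)" for t x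
    by (rule G_growth B_growth)+
  show "integrable M (\<lambda>\<omega>. (1 + (\<epsilon> 0 \<omega>)\<^sup>2) ^ r)" by (rule innovation_moment)
qed

lemma moment_mat_eq: "moment_mat M s p q \<alpha> \<beta> \<epsilon> r = rec.Pmean (int s) s"
  unfolding moment_mat_def rec.Pmean_def Let_def
proof (rule mat_prod_cong)
  fix v assume "v < s"
  then have v: "s - v \<in> {1..s}" and eq: "int s - int v = int s * 0 + int (s - v)" by auto
  show "expect_mat M (d ^ r) (d ^ r) (\<lambda>\<omega>. kron_pow (phi p q \<alpha> \<beta> (s - v) (eta_vec s \<epsilon> 0 \<omega>)) r) =
      rec.mean (int s - int v)"
    unfolding eq rec.mean_def G_time_eta_vec[OF v] ..
qed

lemma innovations_nondegenerate: "\<not> (AE \<omega> in M. \<epsilon> 0 \<omega> = 0)"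
proof
  assume "AE \<omega> in M. \<epsilon> 0 \<omega> = 0"
  then have "(\<integral>\<omega>. \<epsilon> 0 \<omega> ^ 2 \<partial>M) = (\<integral>\<omega>. 0 \<partial>M)"
    by (intro integral_cong_AE) auto
  moreover have "has_bochner_integral M (\<lambda>\<omega>. \<epsilon> 0 \<omega> ^ 2) 1" using innov by (simp add: innovations_def)
  ultimately show False by (simp add: has_bochner_integral_iff)
qed

text \<open>
  Positivity of the accumulated noise. Each step feeds at least \<open>a\<close> times the current squared
  innovation into coordinate \<open>0\<close> and at least \<open>a\<close> into coordinate \<open>p\<close>; the subdiagonal ones
  then shift these amounts through the coordinates, so that after \<open>d\<close> steps all are reached.
\<close>

lemma state_lower_bound:
  assumes a0: "0 \<le> a" and a: "\<And>t. a \<le> \<alpha> 0 (season s t)"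
    and carrier: "\<And>t. u t \<in> carrier_vec d"
    and step: "\<And>t. u t = G t (\<epsilon> t \<omega>) *\<^sub>v u (t - 1) + B t (\<epsilon> t \<omega>)"
    and i: "i < d"
  shows "(rec.P t n \<omega> *\<^sub>v u (t - int n)) $ i +
    (if i < p then (if i < n then a * (\<epsilon> (t - int i) \<omega>)\<^sup>2 else 0) else (if i - p < n then a else 0)) \<le> u t $ i"
  using i
proof (induction n arbitrary: t i)
  case 0
  then show ?case using carrier[of t] by (simp add: rec.P_0)
next
  case (Suc n)
  let ?x = "\<epsilon> t \<omega>" and ?w = "rec.P (t - 1) n \<omega> *\<^sub>v u (t - 1 - int n)"
  note i = Suc.prems
  have w: "?w \<in> carrier_vec d" by (rule mult_mat_vec_carrier[OF rec.P_carrier carrier])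
  have "rec.P t (Suc n) \<omega> *\<^sub>v u (t - int (Suc n)) = G t ?x *\<^sub>v ?w"
    unfolding rec.P_Suc_left
    using assoc_mult_mat_vec[OF G_time_carrier rec.P_carrier carrier] by (simp add: algebra_simps)
  then have lhs: "(rec.P t (Suc n) \<omega> *\<^sub>v u (t - int (Suc n))) $ i = (\<Sum>k<d. G t ?x $$ (i, k) * ?w $ k)"
    using mult_mat_vec_index[OF G_time_carrier w i] by simp
  have rhs: "u t $ i = (\<Sum>k<d. G t ?x $$ (i, k) * u (t - 1) $ k) + B t ?x $ i"
    by (subst step, subst index_add_vec)
       (use i mult_mat_vec_index[OF G_time_carrier carrier i] in auto)
  show ?case
  proof (cases "i = 0 \<or> i = p")
    case True
    have "(\<Sum>k<d. G t ?x $$ (i, k) * ?w $ k) \<le> (\<Sum>k<d. G t ?x $$ (i, k) * u (t - 1) $ k)"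
    proof (intro sum_mono mult_left_mono)
      fix k assume k: "k \<in> {..<d}"
      have "0 \<le> (if k < p then (if k < n then a * (\<epsilon> (t - 1 - int k) \<omega>)\<^sup>2 else 0) else (if k - p < n then a else 0))"
        using a0 by auto
      then show "?w $ k \<le> u (t - 1) $ k" using Suc.IH[of k "t - 1"] k by simp
      show "0 \<le> G t ?x $$ (i, k)" using k i coef_nonneg by (simp add: G_index)
    qed
    moreover have "(if i < p then (if i < Suc n then a * (\<epsilon> (t - int i) \<omega>)\<^sup>2 else 0) else (if i - p < Suc n then a else 0)) \<le> B t ?x $ i"
      using True p a[of t] i by (auto simp: B_index intro: mult_right_mono)
    ultimately show ?thesis unfolding lhs rhs by (rule add_mono)
  next
    case False
    have shift: "(\<Sum>k<d. G t ?x $$ (i, k) * y $ k) = y $ (i - 1)" for y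
    proof -
      have "(\<Sum>k<d. G t ?x $$ (i, k) * y $ k) = (\<Sum>k<d. if k = i - 1 then y $ k else 0)"
        using False i by (intro sum.cong refl) (auto simp: G_index)
      also have "\<dots> = y $ (i - 1)" using i by simp
      finally show ?thesis .
    qed
    have "B t ?x $ i = 0" using False i by (simp add: B_index)
    moreover have "(if i < p then (if i < Suc n then a * (\<epsilon> (t - int i) \<omega>)\<^sup>2 else 0) else (if i - p < Suc n then a else 0)) =
        (if i - 1 < p then (if i - 1 < n then a * (\<epsilon> (t - 1 - int (i - 1)) \<omega>)\<^sup>2 else 0) else (if i - 1 - p < n then a else 0))"
    proof (cases "i < p")
      case True
      then have "i - 1 < p" "i - 1 < n \<longleftrightarrow> i < Suc n" "t - 1 - int (i - 1) = t - int i" using False by auto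
      then show ?thesis using True by (simp only: if_True)
    next
      case i_ge: False
      then have "\<not> i - 1 < p" "i - 1 - p < n \<longleftrightarrow> i - p < Suc n" using False by auto
      then show ?thesis using i_ge by (simp only: if_False)
    qed
    moreover have "i - 1 < d" using i by simp
    ultimately show ?thesis
      using Suc.IH[of "i - 1" "t - 1"] unfolding lhs rhs shift by (simp only: add_0_right)
  qed
qed

text \<open>The state of the process \<open>Y\<close> at a single time \<open>t\<close>.\<close>

definition state :: "(int \<Rightarrow> 'w \<Rightarrow> real vec) \<Rightarrow> int \<Rightarrow> 'w \<Rightarrow> real vec" where
  "state Y t \<omega> = block_state d s (\<lambda>t. Y t \<omega>) t"

lemma state_carrier: "state Y t \<omega> \<in> carrier_vec d"
  by (simp add: state_def)

lemma vec_sum_state: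
  "vec_sum (state Y t \<omega>) = (\<Sum>i<d. Y ((t - 1) div int s) \<omega> $ (d * (season s t - 1) + i))"
  by (simp add: vec_sum_def state_def block_state_def)

lemma state_meas:
  assumes "pgarch_solution M s p q \<alpha> \<beta> \<epsilon> Y"
  shows "(\<lambda>\<omega>. vec_sum (state Y t \<omega>)) \<in> borel_measurable M"
  unfolding vec_sum_state using assms block_index(1)[OF season]
  by (intro borel_measurable_sum) (auto simp: pgarch_solution_def)

lemma state_solution:
  assumes Y: "pgarch_solution M s p q \<alpha> \<beta> \<epsilon> Y"
  shows "AE \<omega> in M. \<forall>t. vec_nonneg (state Y t \<omega>) \<and>
    state Y t \<omega> = G t (\<epsilon> t \<omega>) *\<^sub>v state Y (t - 1) \<omega> + B t (\<epsilon> t \<omega>)"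
proof -
  have "AE \<omega> in M. \<forall>t. \<forall>i<d * s. Y t \<omega> $ i \<ge> 0"
    using Y by (subst AE_all_countable) (auto simp: pgarch_solution_def)
  moreover have "AE \<omega> in M. \<forall>t. Y t \<omega> =
      A_mat s p q \<alpha> \<beta> (eta_vec s \<epsilon> t \<omega>) *\<^sub>v Y (t - 1) \<omega> + B_vec s p q \<alpha> \<beta> (eta_vec s \<epsilon> t \<omega>)"
    using Y by (subst AE_all_countable) (auto simp: pgarch_solution_def)
  ultimately show ?thesis
    using AE_space
  proof eventually_elim
    case (elim \<omega>)
    have car: "\<And>t. Y t \<omega> \<in> carrier_vec (d * s)"
      using Y elim(3) by (auto simp: pgarch_solution_def)
    show ?case
    proof (intro allI conjI)
      fix t
      show "vec_nonneg (state Y t \<omega>)"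
        using elim(1) block_index(1)[OF season] by (auto simp: vec_nonneg_def state_def block_state_def)
      show "state Y t \<omega> = G t (\<epsilon> t \<omega>) *\<^sub>v state Y (t - 1) \<omega> + B t (\<epsilon> t \<omega>)"
        unfolding state_def
        by (rule block_state_step[OF s, of "\<lambda>t. Y t \<omega>", OF car]) (use elim(2) in blast)
    qed
  qed
qed

text \<open>Shifting by whole periods does not change the law of the size of the state.\<close>

lemma state_law:
  assumes Y: "pgarch_solution M s p q \<alpha> \<beta> \<epsilon> Y" and stat: "strictly_stationary M (d * s) Y"
  shows "distr M borel (\<lambda>\<omega>. vec_sum (state Y (t - int (s * j)) \<omega>)) =
    distr M borel (\<lambda>\<omega>. vec_sum (state Y t \<omega>))"
proof -
  let ?k = "(t - 1) div int s" and ?b = "d * (season s t - 1)" and ?I = "{..<d * s}"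
  define f where "f z = (\<Sum>i<d. z (?k, ?b + i))" for z :: "int \<times> nat \<Rightarrow> real"
  define X where "X h \<omega> = (\<lambda>(t, i)\<in>{?k} \<times> ?I. Y (t + h) \<omega> $ i)" for h \<omega>
  have idx: "?b + i \<in> ?I" if "i < d" for i using block_index(1)[OF season that] by simp
  have f [measurable]: "f \<in> borel_measurable (Pi\<^sub>M ({?k} \<times> ?I) (\<lambda>_. borel))"
    unfolding f_def using idx by (intro borel_measurable_sum measurable_component_singleton) auto
  have X: "X h \<in> measurable M (Pi\<^sub>M ({?k} \<times> ?I) (\<lambda>_. borel))" for h
    unfolding X_def using Y
    by (intro measurable_restrict) (auto simp: pgarch_solution_def)
  have per: "season s (t - int (s * j)) = season s t" "(t - int (s * j) - 1) div int s = ?k - int j"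
  proof -
    have eq: "t - int (s * j) = int s * (?k - int j) + int (season s t)"
      using season_decomp[OF s, of t] by (simp add: algebra_simps)
    show "season s (t - int (s * j)) = season s t" "(t - int (s * j) - 1) div int s = ?k - int j"
      unfolding eq by (rule season_div[OF season])+
  qed
  have fX: "f (X h \<omega>) = (\<Sum>i<d. Y (?k + h) \<omega> $ (?b + i))" for h \<omega>
    unfolding f_def X_def using idx by (intro sum.cong refl) simp
  have law: "distr M borel (\<lambda>\<omega>. f (X h \<omega>)) = distr (distr M (Pi\<^sub>M ({?k} \<times> ?I) (\<lambda>_. borel)) (X h)) borel f" for h
    by (subst distr_distr[OF f X]) (simp add: comp_def)
  have "distr M (Pi\<^sub>M ({?k} \<times> ?I) (\<lambda>_. borel)) (X (- int j)) = distr M (Pi\<^sub>M ({?k} \<times> ?I) (\<lambda>_. borel)) (X 0)"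
    using stat[unfolded strictly_stationary_def, rule_format, of "{?k}" "- int j"] by (simp add: X_def[abs_def])
  then have "distr M borel (\<lambda>\<omega>. f (X (- int j) \<omega>)) = distr M borel (\<lambda>\<omega>. f (X 0 \<omega>))"
    unfolding law by simp
  then show ?thesis unfolding fX vec_sum_state per by simp
qed

text \<open>Comparison of the moments of the stacked vector and of its blocks.\<close>

lemma sum_power_bound:
  fixes x :: "nat \<Rightarrow> real"
  assumes "\<And>k. k < n \<Longrightarrow> 0 \<le> x k"
  shows "(\<Sum>k<n. x k) ^ r \<le> 2 ^ r * (\<Sum>k<n. (2 ^ k) ^ r * x k ^ r)"
proof -
  define y where "y k = (if k < n then x k else 0)" for k
  \<comment> \<open>the ratio \<open>1 / 2\<close> is arbitrary, the number \<open>n\<close> of summands being fixed\<close>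
  have "(\<Sum>k<n. y k) ^ r \<le> (1 / (1 - 1 / 2)) ^ r * (\<Sum>k<n. (y k / (1 / 2) ^ k) ^ r)"
    by (rule sum_power_le_geometric) (use assms r in \<open>auto simp: y_def\<close>)
  also have "(\<Sum>k<n. y k) = (\<Sum>k<n. x k)" by (simp add: y_def)
  also have "(\<Sum>k<n. (y k / (1 / 2) ^ k) ^ r) = (\<Sum>k<n. (2 ^ k) ^ r * x k ^ r)"
    by (intro sum.cong refl) (simp add: y_def power_mult_distrib power_one_over field_simps)
  finally show ?thesis by simp
qed

lemma in_L_if_spectral_radius_less_1:
  assumes rho: "real_spectral_radius (moment_mat M s p q \<alpha> \<beta> \<epsilon> r) < 1"
    and Y: "pgarch_solution M s p q \<alpha> \<beta> \<epsilon> Y" and stat: "strictly_stationary M (d * s) Y"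
  shows "in_L M r (Y t)"
proof -
  note state_meas[OF Y, measurable]
  have fin: "integrable M (\<lambda>\<omega>. vec_sum (state Y t \<omega>) ^ r)" for t
  proof (rule integrableI_nonneg)
    show "AE \<omega> in M. 0 \<le> vec_sum (state Y t \<omega>) ^ r"
      using state_solution[OF Y] by eventually_elim (blast intro: zero_le_power vec_sum_nonneg)
    show "(\<integral>\<^sup>+\<omega>. ennreal (vec_sum (state Y t \<omega>) ^ r) \<partial>M) < \<infinity>"
      by (rule rec.nn_integral_power_finite[OF rho[unfolded moment_mat_eq] state_carrier
            state_meas[OF Y] state_solution[OF Y] state_law[OF Y stat]])
  qed measurable
  let ?n = "d * s"
  let ?F = "\<lambda>\<omega>. 2 ^ r * (\<Sum>k<s. (2 ^ k) ^ r * vec_sum (state Y (int s * t + int (k + 1)) \<omega>) ^ r)"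
  have car: "\<And>\<omega>. \<omega> \<in> space M \<Longrightarrow> Y t \<omega> \<in> carrier_vec ?n"
    and comp: "\<And>i. i < ?n \<Longrightarrow> (\<lambda>\<omega>. Y t \<omega> $ i) \<in> borel_measurable M"
    using Y by (auto simp: pgarch_solution_def)
  have nonneg: "AE \<omega> in M. \<forall>i<?n. Y t \<omega> $ i \<ge> 0" using Y by (auto simp: pgarch_solution_def)
  show ?thesis unfolding in_L_def
  proof (rule Bochner_Integration.integrable_bound)
    show "integrable M ?F" by (intro integrable_mult_right Bochner_Integration.integrable_sum fin)
    have "(\<lambda>\<omega>. sqrt (\<Sum>i<?n. (Y t \<omega> $ i)\<^sup>2) ^ r) \<in> borel_measurable M"
      using comp by (intro borel_measurable_power borel_measurable_sqrt borel_measurable_sum) auto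
    also have "(\<lambda>\<omega>. sqrt (\<Sum>i<?n. (Y t \<omega> $ i)\<^sup>2) ^ r) \<in> borel_measurable M \<longleftrightarrow>
        (\<lambda>\<omega>. eucl_norm (Y t \<omega>) ^ r) \<in> borel_measurable M"
      by (rule measurable_cong) (simp add: eucl_norm_def carrier_vecD[OF car])
    finally show "(\<lambda>\<omega>. eucl_norm (Y t \<omega>) ^ r) \<in> borel_measurable M" .
    show "AE \<omega> in M. norm (eucl_norm (Y t \<omega>) ^ r) \<le> norm (?F \<omega>)"
      using nonneg state_solution[OF Y] AE_space
    proof eventually_elim
      case (elim \<omega>)
      have nn: "0 \<le> vec_sum (state Y t \<omega>)" for t using elim(2) by (blast intro: vec_sum_nonneg)
      have norm0: "0 \<le> eucl_norm (Y t \<omega>)" by (auto simp: eucl_norm_def intro: sum_nonneg)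
      have "eucl_norm (Y t \<omega>) \<le> (\<Sum>i<?n. Y t \<omega> $ i)"
        using L2_set_le_sum[of "{..<?n}" "\<lambda>i. Y t \<omega> $ i"] elim(1)
        by (simp add: eucl_norm_def L2_set_def carrier_vecD[OF car[OF elim(3)]])
      also have "\<dots> = (\<Sum>k<s. \<Sum>i<d. Y t \<omega> $ (i + k * d))"
        using sum_mult_product[of "\<lambda>i. Y t \<omega> $ i" s d] by (simp add: mult.commute)
      also have "\<dots> = (\<Sum>k<s. vec_sum (state Y (int s * t + int (k + 1)) \<omega>))"
      proof (intro sum.cong refl)
        fix k assume "k \<in> {..<s}"
        then have k: "k + 1 \<in> {1..s}" by auto
        show "(\<Sum>i<d. Y t \<omega> $ (i + k * d)) = vec_sum (state Y (int s * t + int (k + 1)) \<omega>)"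
          unfolding vec_sum_state season_div[OF k] by (simp add: algebra_simps)
      qed
      finally have "eucl_norm (Y t \<omega>) ^ r \<le> (\<Sum>k<s. vec_sum (state Y (int s * t + int (k + 1)) \<omega>)) ^ r"
        using norm0 by (rule power_mono)
      also have "\<dots> \<le> ?F \<omega>" by (rule sum_power_bound) (rule nn)
      finally show ?case using norm0 by simp
    qed
  qed
qed

text \<open>
  The contrapositive of the nonexistence statement. It uses the moments at one time only, and of
  the coordinates of the Kronecker power only the pure powers.
\<close>

lemma spectral_radius_less_1_if_kron_moment_finite:
  assumes Y: "pgarch_solution M s p q \<alpha> \<beta> \<epsilon> Y"
    and fin: "expect_mat_finite M ((d * s) ^ r) 1 (\<lambda>\<omega>. kron_pow (col_mat (Y 0 \<omega>)) r)"
  shows "real_spectral_radius (moment_mat M s p q \<alpha> \<beta> \<epsilon> r) < 1"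
proof -
  let ?t = "int s"
  have car: "\<And>\<omega>. \<omega> \<in> space M \<Longrightarrow> Y 0 \<omega> \<in> carrier_vec (d * s)"
    using Y by (auto simp: pgarch_solution_def)
  have pow: "integrable M (\<lambda>\<omega>. (Y 0 \<omega> $ i) ^ r)" if i: "i < d * s" for i
  proof -
    obtain I where I: "I < (d * s) ^ r"
      "\<And>x :: real vec. x \<in> carrier_vec (d * s) \<Longrightarrow> kron_pow (col_mat x) r $$ (I, 0) = (x $ i) ^ r"
      using kron_pow_col_mat_diag[OF i, of r] by blast
    have "integrable M (\<lambda>\<omega>. kron_pow (col_mat (Y 0 \<omega>)) r $$ (I, 0))"
      using fin I(1) by (simp add: expect_mat_finite_def)
    also have "integrable M (\<lambda>\<omega>. kron_pow (col_mat (Y 0 \<omega>)) r $$ (I, 0)) \<longleftrightarrow> integrable M (\<lambda>\<omega>. (Y 0 \<omega> $ i) ^ r)"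
      by (rule Bochner_Integration.integrable_cong) (use I(2) car in auto)
    finally show ?thesis .
  qed
  define y where "y k \<omega> = Y 0 \<omega> $ (d * (s - 1) + k)" for k \<omega>
  have idx: "d * (s - 1) + k < d * s" if "k < d" for k using block_index(1)[of s s k d] s that by simp
  have sum_eq: "vec_sum (state Y ?t \<omega>) = (\<Sum>k<d. y k \<omega>)" for \<omega>
    using season_div[of s s 0] s by (simp add: vec_sum_state y_def)
  let ?F = "\<lambda>\<omega>. 2 ^ r * (\<Sum>k<d. (2 ^ k) ^ r * y k \<omega> ^ r)"
  have F: "integrable M ?F"
    unfolding y_def using idx by (intro integrable_mult_right Bochner_Integration.integrable_sum pow) auto
  have nonneg: "AE \<omega> in M. \<forall>i<d * s. Y 0 \<omega> $ i \<ge> 0" using Y by (auto simp: pgarch_solution_def)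
  have "(\<integral>\<^sup>+\<omega>. ennreal (vec_sum (state Y ?t \<omega>) ^ r) \<partial>M) \<le> (\<integral>\<^sup>+\<omega>. ennreal (norm (?F \<omega>)) \<partial>M)"
    using nonneg
  proof (intro nn_integral_mono_AE, eventually_elim)
    case (elim \<omega>)
    have "(\<Sum>k<d. y k \<omega>) ^ r \<le> ?F \<omega>"
      by (rule sum_power_bound) (use elim idx in \<open>auto simp: y_def\<close>)
    also have "\<dots> \<le> norm (?F \<omega>)" by simp
    finally show ?case unfolding sum_eq by (rule ennreal_leI)
  qed
  also have "\<dots> < \<infinity>" using F unfolding integrable_iff_bounded by blast
  finally have finite: "(\<integral>\<^sup>+\<omega>. ennreal (vec_sum (state Y ?t \<omega>) ^ r) \<partial>M) < \<infinity>" .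
  define a where "a = Min (\<alpha> 0 ` {1..s})"
  have a_in: "a \<in> \<alpha> 0 ` {1..s}" unfolding a_def using s by (intro Min_in) auto
  have a: "a > 0" using a_in coeffs by (auto simp: pgarch_coeffs_def)
  have a_le: "a \<le> \<alpha> 0 (season s t)" for t unfolding a_def using season[of t] by (intro Min_le) auto
  have lower: "AE \<omega> in M. \<forall>t. \<forall>i<d.
      (rec.P t (s * d) \<omega> *\<^sub>v state Y (t - int (s * d)) \<omega>) $ i + a * rec.floor_noise p t \<omega> \<le> state Y t \<omega> $ i"
    using state_solution[OF Y]
  proof eventually_elim
    case (elim \<omega>)
    have step: "\<And>t. state Y t \<omega> = G t (\<epsilon> t \<omega>) *\<^sub>v state Y (t - 1) \<omega> + B t (\<epsilon> t \<omega>)"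
      using elim by blast
    show ?case
    proof (intro allI impI)
      fix t i assume i: "i < d"
      have "d \<le> s * d" using s by (cases s) auto
      with i have "i < s * d" by (rule less_le_trans)
      moreover have "i - p \<le> i" by simp
      ultimately have n: "i < s * d" "i - p < s * d" using le_less_trans by blast+
      have "a * rec.floor_noise p t \<omega> \<le> (if i < p then a * (\<epsilon> (t - int i) \<omega>)\<^sup>2 else a)"
        using a rec.floor_noise_le[of i p t \<omega>] rec.floor_noise_le_1[of p t \<omega>]
        by (auto intro: mult_left_mono simp: mult_le_cancel_left1)
      then show "(rec.P t (s * d) \<omega> *\<^sub>v state Y (t - int (s * d)) \<omega>) $ i + a * rec.floor_noise p t \<omega> \<le> state Y t \<omega> $ i"
        using state_lower_bound[of a "\<lambda>t. state Y t \<omega>" \<omega> i t "s * d", OF less_imp_le[OF a] a_le state_carrier step i] n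
        by (simp split: if_splits)
    qed
  qed
  have nn: "AE \<omega> in M. \<forall>t. vec_nonneg (state Y t \<omega>)"
    using state_solution[OF Y] by eventually_elim blast
  show ?thesis
    unfolding moment_mat_eq
    by (rule rec.spectral_radius_less_1_if_moment_finite[of "state Y" a d p, OF state_carrier nn a
        innovations_nondegenerate lower finite])
qed

end

theorem theorem5:
  fixes M :: "'w measure"
    and s p q r :: nat
    and \<alpha> \<beta> :: "nat \<Rightarrow> nat \<Rightarrow> real"
    and \<epsilon> :: "int \<Rightarrow> 'w \<Rightarrow> real"
  assumes "prob_space M"
    and "s \<ge> 1" "p \<ge> 1" "q \<ge> 1"
    and "pgarch_coeffs s p q \<alpha> \<beta>"
    and "innovations M \<epsilon>"
    and "r > 2"
    and "kappa M \<epsilon> (2 * (r - 1)) < \<infinity>"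
  shows "(real_spectral_radius (moment_mat M s p q \<alpha> \<beta> \<epsilon> r) < 1 \<longrightarrow>
           (\<forall>Y. pgarch_solution M s p q \<alpha> \<beta> \<epsilon> Y \<and> strictly_stationary M ((p + q) * s) Y \<longrightarrow>
                (\<forall>t. in_L M r (Y t)))) \<and>
         (real_spectral_radius (moment_mat M s p q \<alpha> \<beta> \<epsilon> r) \<ge> 1 \<longrightarrow>
           \<not> (\<exists>Y. pgarch_solution M s p q \<alpha> \<beta> \<epsilon> Y \<and> strictly_stationary M ((p + q) * s) Y \<and>
                  (\<forall>t. expect_mat_finite M (((p + q) * s) ^ r) 1
                         (\<lambda>\<omega>. kron_pow (col_mat (Y t \<omega>)) r))))"
proof -
  interpret prob_space M by fact
  interpret pgarch M s p q r \<alpha> \<beta> \<epsilon>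
    by unfold_locales (use assms in auto)
  show ?thesis
    using in_L_if_spectral_radius_less_1 spectral_radius_less_1_if_kron_moment_finite by fastforce
qed

end
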